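(* Let $G$ be an undirected, connected, loop-free multigraph with $n\ge 2$ vertices and genus $g\ge 1$. The following two statements are equivalent. (A) (Brill–Noether existence for $\mathbb{R}$-divisors on $G$) For all real numbers $r\ge 0$ and $0\le d\le 2g-2$ with $g-(r+1)(g-d+r)\ge 0$, there exists an $\mathbb{R}$-divisor of degree at most $d$ and rank equal to $r$ on $G$; and if furthermore $g-d+r\ge 1$, then there exists an $\mathbb{R}$-divisor of degree equal to $d$ and rank equal to $r$ on $G$. (B) (Covering radius conjecture for $G$) For every $\lambda\in[1/g,g]$, the covering radii of $\mathcal{N}_G$, $\mathrm{Crit}_{\triangle}(L_G)$ and $\mathrm{Crit}_{\bar\triangle}(L_G)$ with respect to the polytope $P_{1,\lambda}$ are at least $\sqrt{g/\lambda}/n$.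
   Context: For a connected, loop-free multigraph $G=(V,E)$ with $n$ vertices and $m$ edges, the genus is $g=m-n+1$. $\mathbb{R}$-divisors. An $\mathbb{R}$-divisor on $G$ is a formal sum $\sum_{v\in V}a_v(v)$ with $a_v\in\mathbb{R}$, identified with a point of $\mathbb{R}^n$ via a fixed ordering of the vertices; it is a divisor if all $a_v\in\mathbb{Z}$. Its degree is $\sum_v a_v$; it is effective if $a_v\ge 0$ for all $v$. For $f:V\to\mathbb{Z}$ let $Q(f)=\sum_{v\in V}\big(\sum_{(u,v)\in E}(f(v)-f(u))\big)(v)$ (edges counted with multiplicity). $D_1,D_2$ are linearly equivalent if $D_1-D_2=Q(f)$ for some $f:V\to\mathbb{Z}$, and $|D|$ is the set of effective $\mathbb{R}$-divisors linearly equivalent to $D$. The modified rank $\tilde r(D)$ is $k_0-1$, where $k_0$ is the infimum of all $k$ such that there is an effective $\mathbb{R}$-divisor $E$ of degree $k$ with $|D-E|=\emptyset$. The rank is $r(D)=\tilde r\big(D+\sum_{v\in V}(v)\big)$. (For divisors this agrees with the Baker–Norine rank.) $\mathcal{N}_G$ is the set of divisors (integer coefficients) of degree $g-1$ and rank $-1$. The Laplacian lattice $L_G=\{Q(f): f:V\to\mathbb{Z}\}$ is a full rank lattice in $H_0$. Geometry. For $d\in\mathbb{R}$, $H_d=\{x\in\mathbb{R}^n: \sum_i x_i=d\}$. $\triangle\subset H_0$ is the convex hull of $\mathbf{b}_1,\dots,\mathbf{b}_n$, $\mathbf{b}_i=(n-1)\mathbf{e}_i-\sum_{j\ne i}\mathbf{e}_j$,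 and $\bar\triangle=-\triangle$. For $\alpha,\bar\alpha\ge 0$, $P_{\alpha,\bar\alpha}=\alpha\triangle+\bar\alpha\bar\triangle$ (Minkowski sum). For a convex body $C\subset H_0$ containing the origin, $d_C(\mathbf{p}_1,\mathbf{p}_2)=\min\{\mu\ge 0: \mathbf{p}_2\in\mathbf{p}_1+\mu C\}$ for $\mathbf p_1,\mathbf p_2$ in a common $H_d$. For a discrete $T\subset H_d$ invariant under translation by a full rank lattice of $H_0$ with finitely many orbits, $h_{C,T}(\mathbf{p})=\min_{\mu\in T}d_C(\mathbf{p},\mu)$ for $\mathbf{p}\in H_d$, and the covering radius $\mathrm{Cov}_C(T)$ is the maximum of $h_{C,T}$ on $H_d$. $\mathrm{Crit}_{\triangle}(L_G)$ and $\mathrm{Crit}_{\bar\triangle}(L_G)$ are the sets of local maxima in $H_0$ of $h_{\triangle,L_G}$ and $h_{\bar\triangle,L_G}$ respectively. *)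

theory Defs
  imports "HOL-Analysis.Analysis" "HOL-Library.Multiset"
begin

text \<open>
  A multigraph on the finite vertex type \<^typ>\<open>'v\<close> is the multiset of its edges, an edge
  being the set of its end points.  A loop would be a singleton, so a multigraph is loop-free iff all
  its edges have exactly two elements.
\<close>

type_synonym 'v multigraph = "'v set multiset"

definition loopless :: "'v multigraph \<Rightarrow> bool" where
  "loopless G \<longleftrightarrow> (\<forall>e \<in># G. card e = 2)"

definition graph_connected :: "'v multigraph \<Rightarrow> bool" where
  "graph_connected G \<longleftrightarrow> (\<forall>u v. (u, v) \<in> {(x, y). {x, y} \<in># G}\<^sup>*)"

definition genus :: "'v::finite multigraph \<Rightarrow> int" where
  "genus G = int (size G) - int CARD('v) + 1"


type_synonym 'v rdivisor = "real ^ 'v"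

definition is_divisor :: "'v::finite rdivisor \<Rightarrow> bool" where
  "is_divisor D \<longleftrightarrow> (\<forall>v. D $ v \<in> \<int>)"

definition deg :: "'v::finite rdivisor \<Rightarrow> real" where
  "deg D = (\<Sum>v\<in>UNIV. D $ v)"

definition effective :: "'v::finite rdivisor \<Rightarrow> bool" where
  "effective D \<longleftrightarrow> (\<forall>v. 0 \<le> D $ v)"

definition laplacian :: "'v::finite multigraph \<Rightarrow> ('v \<Rightarrow> int) \<Rightarrow> 'v rdivisor" where
  "laplacian G f = (\<chi> v. \<Sum>u\<in>UNIV. real (count G {u, v}) * of_int (f v - f u))"

definition lin_equiv :: "'v::finite multigraph \<Rightarrow> 'v rdivisor \<Rightarrow> 'v rdivisor \<Rightarrow> bool" where
  "lin_equiv G D1 D2 \<longleftrightarrow> (\<exists>f. D1 - D2 = laplacian G f)"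

definition linear_system :: "'v::finite multigraph \<Rightarrow> 'v rdivisor \<Rightarrow> 'v rdivisor set" where
  "linear_system G D = {D'. effective D' \<and> lin_equiv G D' D}"

definition modified_rank :: "'v::finite multigraph \<Rightarrow> 'v rdivisor \<Rightarrow> real" where
  "modified_rank G D =
     Inf {k. \<exists>E. effective E \<and> deg E = k \<and> linear_system G (D - E) = {}} - 1"

definition div_rank :: "'v::finite multigraph \<Rightarrow> 'v rdivisor \<Rightarrow> real" where
  "div_rank G D = modified_rank G (D + (\<Sum>v\<in>UNIV. axis v 1))"

definition nonspecial :: "'v::finite multigraph \<Rightarrow> 'v rdivisor set" where
  "nonspecial G = {D. is_divisor D \<and> deg D = of_int (genus G - 1) \<and> div_rank G D = -1}"

definition laplacian_lattice :: "'v::finite multigraph \<Rightarrow> (real ^ 'v) set" where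
  "laplacian_lattice G = range (laplacian G)"


definition hyp :: "real \<Rightarrow> (real ^ 'v::finite) set" where
  "hyp d = {x. (\<Sum>i\<in>UNIV. x $ i) = d}"

definition simplex_vertex :: "'v::finite \<Rightarrow> real ^ 'v" where
  "simplex_vertex i =
     (real CARD('v) - 1) *\<^sub>R axis i 1 - (\<Sum>j\<in>UNIV - {i}. axis j 1)"

definition std_simplex :: "(real ^ 'v::finite) set" where
  "std_simplex = convex hull (range simplex_vertex)"

definition opp_simplex :: "(real ^ 'v::finite) set" where
  "opp_simplex = uminus ` std_simplex"

definition poly_P :: "real \<Rightarrow> real \<Rightarrow> (real ^ 'v::finite) set" where
  "poly_P a b = {a *\<^sub>R x + b *\<^sub>R y | x y. x \<in> std_simplex \<and> y \<in> opp_simplex}"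

text \<open>
  The minima and the maximum in the next three definitions are written with Inf and Sup.  They are
  attained when \<open>C\<close> is a compact convex subset of \<^term>\<open>hyp 0\<close> containing a
  neighbourhood of the origin in \<^term>\<open>hyp 0\<close>, \<open>T\<close> is a nonempty discrete subset of
  \<^term>\<open>hyp d\<close> consisting of finitely many orbits of a full rank lattice of
  \<^term>\<open>hyp 0\<close>, and the points \<open>p\<close>, \<open>q\<close> lie in \<^term>\<open>hyp d\<close>.
\<close>

definition conv_dist :: "(real ^ 'v::finite) set \<Rightarrow> real ^ 'v \<Rightarrow> real ^ 'v \<Rightarrow> real" where
  "conv_dist C p q = Inf {\<mu>. 0 \<le> \<mu> \<and> q \<in> (\<lambda>x. p + \<mu> *\<^sub>R x) ` C}"

definition dist_fun :: "(real ^ 'v::finite) set \<Rightarrow> (real ^ 'v) set \<Rightarrow> real ^ 'v \<Rightarrow> real" where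
  "dist_fun C T p = (INF t\<in>T. conv_dist C p t)"

definition cov_radius ::
    "real \<Rightarrow> (real ^ 'v::finite) set \<Rightarrow> (real ^ 'v) set \<Rightarrow> real" where
  "cov_radius d C T = (SUP p\<in>hyp d. dist_fun C T p)"

definition crit :: "(real ^ 'v::finite) set \<Rightarrow> (real ^ 'v) set \<Rightarrow> (real ^ 'v) set" where
  "crit C L = {p \<in> hyp 0. \<forall>\<^sub>F q in at p within hyp 0. dist_fun C L q \<le> dist_fun C L p}"

end

theory Submission
  imports Defs
begin

text \<open>
  Write \<open>deg\<^sup>+\<close> for the degree of the positive part and \<open>n\<close> for the number of vertices.
  Both statements say the same about one function, the rank.

  By the theory of reduced divisors and Dhar's burning algorithm, an integral divisor has no effective
  representative iff it lies below a member \<open>\<nu>\<close> of the set \<open>N\<close> of divisors of degree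
  \<open>g - 1\<close> without effective representative
  (\<open>divisor_le_moderator\<close>, \<open>linear_system_empty_iff_moderator\<close>).  Hence the rank of a
  real divisor \<open>D\<close> is the infimum of \<open>deg\<^sup>+(D - \<nu>) - 1\<close> over \<open>\<nu> \<in> N\<close>
  (\<open>div_rank_eq_excess\<close>), and \<open>N\<close> is the set of divisors of degree \<open>g - 1\<close> and rank
  \<open>-1\<close>.  In particular the rank is continuous, monotone and invariant under the Laplacian lattice,
  which is cocompact in the hyperplane of degree zero; so the rank attains its maximum on divisors of
  given degree, and by connectedness all values between this maximum and its minimum.

  On the other side, \<open>\<mu>\<close> is an admissible scaling factor for the polytope
  \<open>P\<^sub>1\<^sub>,\<^sub>\<kappa>\<close> from \<open>p\<close> to \<open>t\<close> iff
  \<open>deg\<^sup>+(p - t - \<mu>(1 - \<kappa>)) \<le> n\<mu>\<kappa>\<close> (\<open>mem_scaled_poly_P_iff\<close>).  So the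
  covering radius of \<open>N\<close> is at least \<open>\<mu>\<close> iff some divisor of degree
  \<open>g - 1 - n\<mu>(1 - \<kappa>)\<close> has rank at least \<open>n\<mu>\<kappa> - 1\<close>
  (\<open>cov_radius_moderators_ge_iff_rank\<close>).  For \<open>\<mu> = sqrt (g / \<kappa>) / n\<close> the rank
  \<open>r\<close> and degree \<open>d\<close> in question satisfy \<open>r + 1 = sqrt (g\<kappa>)\<close> and
  \<open>g - d + r = sqrt (g / \<kappa>)\<close>.  As \<open>\<kappa>\<close> runs through \<open>[1/g, g]\<close> these pairs
  make up the curve \<open>(r + 1)(g - d + r) = g\<close> with both factors in \<open>[1, g]\<close>, and existence
  on this curve implies existence at the other pairs \<open>(r, d)\<close> by monotonicity and continuity of
  the rank.

  The local maxima of the two simplex distances are the points \<open>c - \<nu>\<close> and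
  \<open>\<nu> - c\<close>, where \<open>c\<close> is the constant vector of degree \<open>g - 1\<close>
  (\<open>crit_std_simplex\<close>, \<open>crit_opp_simplex\<close>).  The second set is a translate of
  \<open>N\<close>, with the same covering radii.  The first one is a reflection, for which the bound at
  \<open>\<kappa>\<close> is the bound for \<open>N\<close> at \<open>1 / \<kappa>\<close>.
\<close>

section \<open>Degree and Laplacian\<close>

abbreviation edge_mult :: "'v multigraph \<Rightarrow> 'v \<Rightarrow> 'v \<Rightarrow> real" where
  "edge_mult G u v \<equiv> real (count G {u, v})"

text \<open>
  The Laplacian with real potentials in place of integer ones.
\<close>

definition real_laplacian :: "'v::finite multigraph \<Rightarrow> real ^ 'v \<Rightarrow> real ^ 'v" where
  "real_laplacian G x = (\<chi> v. \<Sum>u\<in>UNIV. edge_mult G u v * (x $ v - x $ u))"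

lemma edge_mult_commute: "edge_mult G u v = edge_mult G v u"
  by (simp add: insert_commute)

lemma laplacian_eq_real: "laplacian G f = real_laplacian G (\<chi> v. of_int (f v))"
  by (simp add: laplacian_def real_laplacian_def)

lemma linear_real_laplacian: "linear (real_laplacian G)"
  by (rule linearI)
    (simp_all add: real_laplacian_def vec_eq_iff algebra_simps sum.distrib sum_subtractf sum_distrib_left)

lemma laplacian_add: "laplacian G (\<lambda>v. f v + h v) = laplacian G f + laplacian G h"
  by (simp add: laplacian_def vec_eq_iff algebra_simps sum.distrib sum_subtractf)

lemma laplacian_minus: "laplacian G (\<lambda>v. - f v) = - laplacian G f"
  by (simp add: laplacian_def vec_eq_iff algebra_simps sum.distrib sum_subtractf)

lemma deg_add: "deg (x + y) = deg x + deg y"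
  and deg_diff: "deg (x - y) = deg x - deg y"
  and deg_minus: "deg (- x) = - deg x"
  and deg_scaleR: "deg (c *\<^sub>R x) = c * deg x"
  and deg_vec: "deg (vec c :: real ^ 'v::finite) = real CARD('v) * c"
  for x y :: "real ^ 'v::finite"
  by (simp_all add: deg_def sum.distrib sum_subtractf sum_negf sum_distrib_left)

lemma mem_hyp: "x \<in> hyp d \<longleftrightarrow> deg x = d"
  by (simp add: hyp_def deg_def)

lemma deg_real_laplacian: "deg (real_laplacian G x) = 0"
proof -
  have "deg (real_laplacian G x) = (\<Sum>v\<in>UNIV. \<Sum>u\<in>UNIV. edge_mult G u v * (x $ v - x $ u))"
    by (simp add: deg_def real_laplacian_def)
  also have "\<dots> = (\<Sum>v\<in>UNIV. \<Sum>u\<in>UNIV. edge_mult G v u * (x $ u - x $ v))"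
    by (rule sum.swap)
  also have "\<dots> = (\<Sum>v\<in>UNIV. \<Sum>u\<in>UNIV. - (edge_mult G u v * (x $ v - x $ u)))"
    by (intro sum.cong refl) (simp add: edge_mult_commute algebra_simps)
  also have "\<dots> = - deg (real_laplacian G x)"
    by (simp add: deg_def real_laplacian_def sum_negf)
  finally show ?thesis by simp
qed

lemma deg_laplacian: "deg (laplacian G f) = 0"
  by (simp add: laplacian_eq_real deg_real_laplacian)

lemma is_divisor_laplacian: "is_divisor (laplacian G f)"
  by (auto simp: is_divisor_def laplacian_def intro!: Ints_sum Ints_mult Ints_diff)

lemma Ints_less_add1:
  fixes a b :: real
  assumes "a \<in> \<int>" "b \<in> \<int>" "a < b" shows "a + 1 \<le> b"
proof -
  obtain i j where "a = of_int i" "b = of_int j" using assms by (auto elim!: Ints_cases)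
  then show ?thesis using assms(3) by simp
qed

text \<open>
  The maximum principle: where a harmonic function attains its maximum, it attains it at all
  neighbours as well.
\<close>

lemma real_laplacian_eq_0_imp_const:
  fixes G :: "'v::finite multigraph"
  assumes conn: "graph_connected G" and z: "real_laplacian G x = 0"
  shows "x $ u = x $ v"
proof -
  define M where "M = Max (range (\<lambda>v. x $ v))"
  have le: "x $ v \<le> M" for v unfolding M_def by (rule Max_ge) auto
  have "M \<in> range (\<lambda>v. x $ v)" unfolding M_def by (rule Max_in) auto
  then obtain q where q: "x $ q = M" by auto
  have "x $ w = M" for w
  proof -
    have "(q, w) \<in> {(x, y). {x, y} \<in># G}\<^sup>*" using conn by (auto simp: graph_connected_def)
    then show ?thesis
    proof (induction rule: rtrancl_induct)
      case base show ?case by (rule q)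
    next
      case (step v w)
      have "(\<Sum>u\<in>UNIV. edge_mult G u v * (M - x $ u)) = 0"
        using arg_cong[OF z, of "\<lambda>y. y $ v"] unfolding real_laplacian_def step.IH by (simp add: step.IH)
      moreover have "\<forall>u\<in>UNIV. 0 \<le> edge_mult G u v * (M - x $ u)" using le by simp
      ultimately have "edge_mult G w v * (M - x $ w) = 0"
        by (subst (asm) sum_nonneg_eq_0_iff) auto
      moreover have "count G {w, v} \<noteq> 0" using step.hyps by (auto simp: insert_commute)
      ultimately show ?case by simp
    qed
  qed
  then show ?thesis by simp
qed

text \<open>
  Adding the degree as a multiple of the all-one vector makes the real Laplacian injective on
  the whole space, hence bijective; the degree tells the two summands apart.
\<close>

lemma real_laplacian_surj:
  fixes G :: "'v::finite multigraph"
  assumes conn: "graph_connected G" and p: "deg p = 0"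
  obtains x where "real_laplacian G x = p"
proof -
  define T where "T x = real_laplacian G x + vec (deg x)" for x :: "real ^ 'v"
  have lin: "linear T"
    by (rule linearI) (simp_all add: T_def linear_add[OF linear_real_laplacian]
       linear_scale[OF linear_real_laplacian] deg_add deg_scaleR vec_eq_iff algebra_simps)
  have degT: "deg (T x) = real CARD('v) * deg x" for x
    by (simp add: T_def deg_add deg_real_laplacian deg_vec)
  have "inj T"
  proof (subst linear_injective_0[OF lin], intro allI impI)
    fix x assume x: "T x = 0"
    then have "deg x = 0" using degT[of x] by (simp add: deg_def)
    with x have "real_laplacian G x = 0" by (simp add: T_def vec_eq_iff)
    then have c: "x $ u = x $ v" for u v by (rule real_laplacian_eq_0_imp_const[OF conn])
    have "x $ v = 0" for v
    proof -
      have "deg x = real CARD('v) * x $ v"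
        unfolding deg_def by (subst sum.cong[OF refl c[of _ v]]) simp
      with \<open>deg x = 0\<close> show ?thesis by simp
    qed
    then show "x = 0" by (simp add: vec_eq_iff)
  qed
  then have "surj T" by (intro linear_injective_imp_surjective[OF lin] refl)
  then obtain x where x: "T x = p" by (metis surjD)
  have "deg x = 0" using degT[of x] x p by simp
  with x have "real_laplacian G x = p" by (simp add: T_def vec_eq_iff)
  then show ?thesis by (rule that)
qed

text \<open>
  The Laplacian lattice is cocompact in the hyperplane of degree zero: round down the real
  potential of a point.
\<close>

lemma laplacian_rounding:
  fixes G :: "'v::finite multigraph"
  assumes conn: "graph_connected G"
  obtains B where "\<And>p. deg p = 0 \<Longrightarrow> \<exists>f. \<forall>v. \<bar>p $ v - laplacian G f $ v\<bar> \<le> B"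
proof
  let ?B = "\<Sum>v\<in>UNIV. \<Sum>u\<in>UNIV. edge_mult G u v"
  fix p :: "real ^ 'v" assume "deg p = 0"
  then obtain x where x: "real_laplacian G x = p" using real_laplacian_surj[OF conn] by metis
  have "\<bar>p $ v - laplacian G (\<lambda>v. \<lfloor>x $ v\<rfloor>) $ v\<bar> \<le> ?B" for v
  proof -
    have "p $ v - laplacian G (\<lambda>v. \<lfloor>x $ v\<rfloor>) $ v
        = (\<Sum>u\<in>UNIV. edge_mult G u v * (frac (x $ v) - frac (x $ u)))"
      by (simp add: x[symmetric] real_laplacian_def laplacian_def frac_def sum_subtractf[symmetric] algebra_simps)
    also have "\<bar>\<dots>\<bar> \<le> (\<Sum>u\<in>UNIV. \<bar>edge_mult G u v * (frac (x $ v) - frac (x $ u))\<bar>)"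
      by (rule sum_abs)
    also have "\<dots> \<le> (\<Sum>u\<in>UNIV. edge_mult G u v)"
    proof (rule sum_mono)
      fix u
      have "0 \<le> frac (x $ v)" "frac (x $ v) < 1" "0 \<le> frac (x $ u)" "frac (x $ u) < 1"
        by (simp_all add: frac_lt_1)
      then have "\<bar>frac (x $ v) - frac (x $ u)\<bar> \<le> 1" by linarith
      then show "\<bar>edge_mult G u v * (frac (x $ v) - frac (x $ u))\<bar> \<le> edge_mult G u v"
        by (simp add: abs_mult mult_left_le)
    qed
    also have "\<dots> \<le> ?B"
      by (rule member_le_sum[of v UNIV "\<lambda>v. \<Sum>u\<in>UNIV. edge_mult G u v"]) (auto intro: sum_nonneg)
    finally show ?thesis .
  qed
  then show "\<exists>f. \<forall>v. \<bar>p $ v - laplacian G f $ v\<bar> \<le> ?B" by blast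
qed

section \<open>Reduced divisors and moderators\<close>

lemma linear_system_empty_iff:
  "linear_system G D = {} \<longleftrightarrow> (\<forall>f. \<exists>v. D $ v + laplacian G f $ v < 0)"
proof -
  have "D' - D = laplacian G f \<longleftrightarrow> D' = D + laplacian G f" for D' f by (auto simp: algebra_simps)
  then have "linear_system G D \<noteq> {} \<longleftrightarrow> (\<exists>f. effective (D + laplacian G f))"
    by (auto simp: linear_system_def lin_equiv_def)
  then have "linear_system G D = {} \<longleftrightarrow> (\<forall>f. \<not> effective (D + laplacian G f))" by blast
  then show ?thesis by (simp add: effective_def not_le)
qed

lemma linear_system_empty_diff:
  "linear_system G D = {} \<Longrightarrow> \<exists>v. (D - laplacian G f) $ v < 0"
  unfolding linear_system_empty_iff using laplacian_minus[of G f]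
  by (metis vector_add_component add_uminus_conv_diff)

text \<open>
  A divisor without effective representative has a representative \<open>D'\<close> in which no set of
  vertices can fire: every nonempty \<open>A\<close> has a vertex whose coefficient is less than the number
  of its edges leaving \<open>A\<close>.  For a fixed vertex \<open>q\<close> one takes, among the potentials
  vanishing at \<open>q\<close>, above a suitable \<open>f0\<close>, and making all coefficients away from
  \<open>q\<close> nonnegative, one with the largest sum.  These potentials are bounded above, because the
  coefficient at \<open>q\<close> is bounded below along \<open>f \<ge> f0\<close> and the degree is fixed, so that
  all coefficients are bounded above; bounds on \<open>f\<close> then spread from \<open>q\<close> along edges.
  The sets \<open>A\<close> containing \<open>q\<close> need no firing argument, as the coefficient at \<open>q\<close> is
  negative.
\<close>

lemma exists_reduced_divisor:
  fixes G :: "'v::finite multigraph"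
  assumes conn: "graph_connected G" and D: "is_divisor D" and empty: "linear_system G D = {}"
  obtains f where "\<And>A. A \<noteq> {} \<Longrightarrow>
    \<exists>v\<in>A. (D - laplacian G f) $ v + 1 \<le> (\<Sum>u\<in>-A. edge_mult G u v)"
proof -
  obtain q :: 'v where True by simp
  have int: "(D - laplacian G f) $ v \<in> \<int>" for f v
    using D is_divisor_laplacian[of G f] by (simp add: is_divisor_def)
  have lap_shift: "laplacian G (\<lambda>v. f v - k) = laplacian G f" for f k
    by (simp add: laplacian_def vec_eq_iff)
  have neg: "(D - laplacian G f) $ q < 0" if "\<And>v. v \<noteq> q \<Longrightarrow> 0 \<le> (D - laplacian G f) $ v" for f
    using linear_system_empty_diff[OF empty, of f] that by (metis not_le)
  \<comment> \<open>The target \<open>w\<close> equals the rounding error \<open>B\<close> away from \<open>q\<close>, so the rounded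
     divisor is nonnegative there.\<close>
  obtain f0 where f0q: "f0 q = 0" and f0: "\<And>v. v \<noteq> q \<Longrightarrow> 0 \<le> (D - laplacian G f0) $ v"
  proof -
    obtain B where B: "\<And>p. deg p = 0 \<Longrightarrow> \<exists>f. \<forall>v. \<bar>p $ v - laplacian G f $ v\<bar> \<le> B"
      using laplacian_rounding[OF conn] by metis
    define w :: "real ^ 'v" where
      "w = (\<chi> v. if v = q then deg D - (real CARD('v) - 1) * B else B)"
    have "deg w = (\<Sum>v\<in>insert q (UNIV - {q}). w $ v)" by (simp add: deg_def insert_absorb)
    also have "\<dots> = deg D"
      by (subst sum.insert) (simp_all add: w_def card_Diff_singleton of_nat_diff algebra_simps)
    finally have "deg (D - w) = 0" by (simp add: deg_diff)
    from B[OF this] obtain f where f: "\<And>v. \<bar>(D - w) $ v - laplacian G f $ v\<bar> \<le> B" by blast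
    show ?thesis
    proof (rule that[of "\<lambda>v. f v - f q"])
      fix v assume "v \<noteq> q"
      then show "0 \<le> (D - laplacian G (\<lambda>v. f v - f q)) $ v"
        using f[of v] unfolding lap_shift by (simp add: w_def)
    qed simp
  qed
  define X where "X = {f. f q = 0 \<and> (\<forall>v. f0 v \<le> f v) \<and> (\<forall>v. v \<noteq> q \<longrightarrow> 0 \<le> (D - laplacian G f) $ v)}"
  have f0X: "f0 \<in> X" using f0q f0 by (simp add: X_def)
  define M where "M = max 0 (deg D - (D - laplacian G f0) $ q)"
  have le_M: "(D - laplacian G f) $ v \<le> M" if f: "f \<in> X" for f v
  proof (cases "v = q")
    case True
    then show ?thesis using neg[of f] f by (force simp: M_def X_def)
  next
    case False
    have "laplacian G f $ q \<le> laplacian G f0 $ q"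
      using f f0q unfolding X_def laplacian_def by (auto intro!: sum_mono mult_left_mono)
    then have 1: "(D - laplacian G f0) $ q \<le> (D - laplacian G f) $ q" by simp
    have "deg D = deg (D - laplacian G f)" by (simp add: deg_diff deg_laplacian)
    also have "\<dots> = (D - laplacian G f) $ q + (\<Sum>v\<in>UNIV-{q}. (D - laplacian G f) $ v)"
      unfolding deg_def by (rule sum.remove) auto
    finally have "deg D = (D - laplacian G f) $ q + (\<Sum>v\<in>UNIV-{q}. (D - laplacian G f) $ v)" .
    moreover have "(D - laplacian G f) $ v \<le> (\<Sum>v\<in>UNIV-{q}. (D - laplacian G f) $ v)"
      using False f by (intro member_le_sum) (auto simp: X_def)
    ultimately have "(D - laplacian G f) $ v \<le> deg D - (D - laplacian G f) $ q" by linarith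
    with 1 show ?thesis by (simp add: M_def)
  qed
  have bounded: "\<exists>b. \<forall>f\<in>X. real_of_int (f w) \<le> b" for w
  proof -
    have "(q, w) \<in> {(x, y). {x, y} \<in># G}\<^sup>*" using conn by (auto simp: graph_connected_def)
    then show ?thesis
    proof (induction rule: rtrancl_induct)
      case base show ?case by (intro exI[of _ 0]) (simp add: X_def)
    next
      case (step v w)
      then obtain b where b: "\<And>f. f \<in> X \<Longrightarrow> real_of_int (f v) \<le> b" by blast
      let ?d = "\<Sum>u\<in>UNIV. edge_mult G u v"
      let ?b = "f0 w + (M - D $ v + ?d * b - (\<Sum>u\<in>UNIV. edge_mult G u v * f0 u))"
      have "f w \<le> ?b" if f: "f \<in> X" for f
      proof -
        have ge: "f0 u \<le> f u" for u using f by (simp add: X_def)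
        have "count G {w, v} \<noteq> 0" using step.hyps by (auto simp: insert_commute)
        then have "1 \<le> edge_mult G w v" by simp
        then have "real_of_int (f w - f0 w) \<le> edge_mult G w v * (f w - f0 w)"

          using mult_right_mono[of 1 "edge_mult G w v" "real_of_int (f w - f0 w)"] ge[of w] by simp
        also have "\<dots> \<le> (\<Sum>u\<in>UNIV. edge_mult G u v * (f u - f0 u))"
          using ge by (intro member_le_sum) auto
        finally have 1: "real_of_int (f w) - f0 w \<le> (\<Sum>u\<in>UNIV. edge_mult G u v * f u) - (\<Sum>u\<in>UNIV. edge_mult G u v * f0 u)"
          by (simp add: algebra_simps sum_subtractf)
        have "(D - laplacian G f) $ v = D $ v - ?d * f v + (\<Sum>u\<in>UNIV. edge_mult G u v * f u)"
          by (simp add: laplacian_def algebra_simps sum_subtractf sum_distrib_left)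
        moreover have "?d * f v \<le> ?d * b" using b[OF f] by (intro mult_left_mono sum_nonneg) auto
        ultimately show ?thesis using 1 le_M[OF f, of v] by linarith
      qed
      then show ?case by blast
    qed
  qed
  then obtain b where b: "\<And>f w. f \<in> X \<Longrightarrow> real_of_int (f w) \<le> b w" by metis
  define m where "m f = nat (\<Sum>v\<in>UNIV. f v - f0 v)" for f
  have "m f < nat (\<Sum>v\<in>UNIV. \<lfloor>b v\<rfloor> - f0 v) + 1" if "f \<in> X" for f
  proof -
    have "f v \<le> \<lfloor>b v\<rfloor>" for v using b[OF that, of v] by (simp add: le_floor_iff)
    then have "(\<Sum>v\<in>UNIV. f v - f0 v) \<le> (\<Sum>v\<in>UNIV. \<lfloor>b v\<rfloor> - f0 v)" by (intro sum_mono) auto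
    then show ?thesis unfolding m_def by linarith
  qed
  then obtain f where fX: "f \<in> X" and fmax: "\<And>h. h \<in> X \<Longrightarrow> m h \<le> m f"
    using ex_has_greatest_nat[of "\<lambda>f. f \<in> X" f0 m "nat (\<Sum>v\<in>UNIV. \<lfloor>b v\<rfloor> - f0 v) + 1"] f0X
    by (metis less_imp_le)
  show ?thesis
  proof (rule that[of f])
    fix A :: "'v set" assume A: "A \<noteq> {}"
    have qneg: "(D - laplacian G f) $ q < 0" using neg[of f] fX by (simp add: X_def)
    show "\<exists>v\<in>A. (D - laplacian G f) $ v + 1 \<le> (\<Sum>u\<in>-A. edge_mult G u v)"
    proof (cases "q \<in> A")
      case True
      have "(D - laplacian G f) $ q + 1 \<le> 0" using Ints_less_add1[OF int Ints_0 qneg] .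
      also have "0 \<le> (\<Sum>u\<in>-A. edge_mult G u q)" by (simp add: sum_nonneg)
      finally show ?thesis using True by blast
    next
      case False
      define i where "i v = (if v \<in> A then 1 else 0 :: int)" for v
      define h where "h v = f v + i v" for v
      have "(\<Sum>v\<in>UNIV. i v) = int (card A)"
        by (simp add: i_def sum.If_cases)
      then have "(\<Sum>v\<in>UNIV. h v - f0 v) = (\<Sum>v\<in>UNIV. f v - f0 v) + int (card A)"
        by (simp add: h_def sum.distrib sum_subtractf)
      moreover have "card A > 0" using A by (simp add: card_gt_0_iff)
      moreover have "(\<Sum>v\<in>UNIV. f v - f0 v) \<ge> 0" using fX by (intro sum_nonneg) (simp add: X_def)
      ultimately have "m f < m h" unfolding m_def by linarith
      then have "h \<notin> X" using fmax[of h] by auto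
      moreover have "h q = 0" "f0 v \<le> h v" for v
        using fX False by (auto simp: X_def h_def i_def add_increasing2)
      ultimately obtain v where v: "v \<noteq> q" "(D - laplacian G h) $ v < 0"
        by (auto simp: X_def not_le)
      have nonneg: "0 \<le> (D - laplacian G f) $ v" using fX v(1) by (simp add: X_def)
      have lap: "laplacian G h = laplacian G f + laplacian G i"
        unfolding h_def by (rule laplacian_add)
      have "v \<in> A"
      proof (rule ccontr)
        assume "v \<notin> A"
        then have "laplacian G i $ v \<le> 0"
          by (auto simp: laplacian_def i_def intro!: sum_nonpos)
        then show False using v(2) nonneg by (simp add: lap)
      qed
      then have "laplacian G i $ v = (\<Sum>u\<in>UNIV. if u \<in> -A then edge_mult G u v else 0)"
        unfolding laplacian_def by (auto simp: i_def intro!: sum.cong)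
      also have "\<dots> = (\<Sum>u\<in>-A. edge_mult G u v)" by (simp only: sum.inter_restrict[OF finite, symmetric] Int_UNIV_left)
      finally have "(D - laplacian G f) $ v < (\<Sum>u\<in>-A. edge_mult G u v)"
        using v(2) by (simp add: lap)
      then have "(D - laplacian G f) $ v + 1 \<le> (\<Sum>u\<in>-A. edge_mult G u v)"
        by (intro Ints_less_add1 int) (auto intro: Ints_sum)
      then show ?thesis using \<open>v \<in> A\<close> by blast
    qed
  qed
qed

text \<open>
  Dhar's burning algorithm: repeatedly applying the hypothesis to the set of unburnt vertices
  orders the vertices in such a way that every coefficient is less than the number of edges to earlier
  vertices.
\<close>

lemma burning_order:
  fixes G :: "'v::finite multigraph" and D :: "real ^ 'v"
  assumes red: "\<And>A. A \<noteq> {} \<Longrightarrow> \<exists>v\<in>A. D $ v + 1 \<le> (\<Sum>u\<in>-A. edge_mult G u v)"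
  obtains \<rho> :: "'v \<Rightarrow> nat" where "inj \<rho>"
    "\<And>v. D $ v + 1 \<le> (\<Sum>u | \<rho> u < \<rho> v. edge_mult G u v)"
proof -
  have "\<exists>B (\<rho>::'v \<Rightarrow> nat). card B = k \<and> inj_on \<rho> B \<and> \<rho> ` B \<subseteq> {..<k} \<and>
     (\<forall>v\<in>B. D $ v + 1 \<le> (\<Sum>u | u \<in> B \<and> \<rho> u < \<rho> v. edge_mult G u v))" if "k \<le> CARD('v)" for k
    using that
  proof (induction k)
    case 0 show ?case by (intro exI[of _ "{}"]) auto
  next
    case (Suc k)
    then obtain B and \<rho> :: "'v \<Rightarrow> nat" where B: "card B = k" "inj_on \<rho> B" "\<rho> ` B \<subseteq> {..<k}"
      and *: "\<And>v. v \<in> B \<Longrightarrow> D $ v + 1 \<le> (\<Sum>u | u \<in> B \<and> \<rho> u < \<rho> v. edge_mult G u v)" by force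
    have "B \<noteq> UNIV" using Suc.prems B(1) by auto
    then have "-B \<noteq> {}" by blast
    from red[OF this] obtain v where v: "v \<notin> B" "D $ v + 1 \<le> (\<Sum>u\<in>B. edge_mult G u v)" by auto
    let ?r = "\<rho>(v := k)"
    have lt: "u \<in> B \<Longrightarrow> \<rho> u < k" for u using B(3) by auto
    have 1: "{u. u \<in> insert v B \<and> ?r u < ?r v} = B" using lt v(1) by auto
    have 2: "{u. u \<in> insert v B \<and> ?r u < ?r w} = {u. u \<in> B \<and> \<rho> u < \<rho> w}" if "w \<in> B" for w
      using lt[OF that] v(1) that by auto
    have "card (insert v B) = Suc k" using v(1) B(1) by simp
    moreover have "inj_on ?r (insert v B)" using B(2) lt v(1) by (auto simp: inj_on_def)
    moreover have "?r ` insert v B \<subseteq> {..<Suc k}" using lt v(1) by (auto simp: less_Suc_eq)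
    moreover have "\<forall>w\<in>insert v B. D $ w + 1 \<le> (\<Sum>u | u \<in> insert v B \<and> ?r u < ?r w. edge_mult G u w)"
    proof
      fix w assume w: "w \<in> insert v B"
      show "D $ w + 1 \<le> (\<Sum>u | u \<in> insert v B \<and> ?r u < ?r w. edge_mult G u w)"
      proof (cases "w = v")
        case True
        show ?thesis unfolding True 1 by (rule v(2))
      next
        case False
        with w have "w \<in> B" by simp
        show ?thesis unfolding 2[OF \<open>w \<in> B\<close>] by (rule *[OF \<open>w \<in> B\<close>])
      qed
    qed
    ultimately show ?case by blast
  qed
  from this[of "CARD('v)"] obtain B and \<rho> :: "'v \<Rightarrow> nat" where B: "card B = CARD('v)" "inj_on \<rho> B"
      and *: "\<And>v. v \<in> B \<Longrightarrow> D $ v + 1 \<le> (\<Sum>u | u \<in> B \<and> \<rho> u < \<rho> v. edge_mult G u v)" by force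
  have "B = UNIV" using B(1) by (simp add: card_eq_UNIV_imp_eq_UNIV)
  with B(2) * show ?thesis by (intro that[of \<rho>]) auto
qed

text \<open>
  The divisor of the acyclic orientation induced by a vertex order: the in-degree minus one,
  for the orientation in which every edge points to its later end.  The order is given by an injective
  numbering \<open>\<rho>\<close>.
\<close>

definition order_divisor :: "'v::finite multigraph \<Rightarrow> ('v \<Rightarrow> nat) \<Rightarrow> 'v rdivisor" where
  "order_divisor G \<rho> = (\<chi> v. (\<Sum>u | \<rho> u < \<rho> v. edge_mult G u v) - 1)"

lemma is_divisor_order_divisor: "is_divisor (order_divisor G \<rho>)"
  by (auto simp: is_divisor_def order_divisor_def intro!: Ints_diff Ints_sum)

lemma deg_order_divisor:
  fixes G :: "'v::finite multigraph"
  assumes "loopless G" "inj \<rho>"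
  shows "deg (order_divisor G \<rho>) = of_int (genus G - 1)"
proof -
  let ?P = "{(u, v). \<rho> u < \<rho> v}"
  have "deg (order_divisor G \<rho>) = (\<Sum>v\<in>UNIV. \<Sum>u | \<rho> u < \<rho> v. edge_mult G u v) - real CARD('v)"
    by (simp add: deg_def order_divisor_def sum_subtractf)
  also have "(\<Sum>v\<in>UNIV. \<Sum>u | \<rho> u < \<rho> v. edge_mult G u v) = (\<Sum>(v, u)\<in>(SIGMA v:UNIV. {u. \<rho> u < \<rho> v}). edge_mult G u v)"
    by (rule sum.Sigma) auto
  also have "\<dots> = (\<Sum>e\<in>{e. card e = 2}. real (count G e))"
  proof -
    have "bij_betw (\<lambda>(v, u). {u, v}) (SIGMA v:UNIV. {u. \<rho> u < \<rho> v}) {e. card e = 2}"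
      unfolding bij_betw_def
    proof
      show "inj_on (\<lambda>(v, u). {u, v}) (SIGMA v:UNIV. {u. \<rho> u < \<rho> v})"
        by (auto simp: inj_on_def doubleton_eq_iff)
      show "(\<lambda>(v, u). {u, v}) ` (SIGMA v:UNIV. {u. \<rho> u < \<rho> v}) = {e. card e = 2}"
      proof (intro equalityI subsetI)
        fix e :: "'v set" assume "e \<in> {e. card e = 2}"
        then obtain x y where xy: "e = {x, y}" "x \<noteq> y" by (auto simp: card_2_iff)
        then have "\<rho> x \<noteq> \<rho> y" using assms(2) by (auto dest: injD)
        then consider "\<rho> x < \<rho> y" | "\<rho> y < \<rho> x" by linarith
        then show "e \<in> (\<lambda>(v, u). {u, v}) ` (SIGMA v:UNIV. {u. \<rho> u < \<rho> v})"
          by cases (auto simp: xy image_iff insert_commute)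
      qed (auto simp: card_2_iff)
    qed
    from sum.reindex_bij_betw[OF this, of "\<lambda>e. real (count G e)"]
    show ?thesis by (simp add: case_prod_unfold insert_commute)
  qed
  also have "\<dots> = (\<Sum>e\<in>set_mset G. real (count G e))"
    using assms(1) by (intro sum.mono_neutral_right) (auto simp: loopless_def not_in_iff)
  also have "\<dots> = real (size G)" by (simp add: size_multiset_overloaded_eq)
  finally show ?thesis by (simp add: genus_def)
qed

text \<open>
  Whatever is added by a potential \<open>f\<close>, the first vertex at which \<open>f\<close> is minimal
  loses at least its edges to earlier vertices, and its coefficient becomes negative.
\<close>

lemma linear_system_order_divisor:
  fixes G :: "'v::finite multigraph"
  assumes "inj \<rho>"
  shows "linear_system G (order_divisor G \<rho>) = {}"
  unfolding linear_system_empty_iff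
proof
  fix f :: "'v \<Rightarrow> int"
  define mf where "mf = Min (range f)"
  have mf: "mf \<le> f v" for v unfolding mf_def by (rule Min_le) auto
  have "mf \<in> range f" unfolding mf_def by (rule Min_in) auto
  then obtain v0 where "f v0 = mf" by auto
  from ex_has_least_nat[of "\<lambda>v. f v = mf" v0 \<rho>, OF this]
  obtain v where v: "f v = mf" "\<And>u. f u = mf \<Longrightarrow> \<rho> v \<le> \<rho> u" by blast
  have "laplacian G f $ v \<le> (\<Sum>u\<in>UNIV. if \<rho> u < \<rho> v then - edge_mult G u v else 0)"
    unfolding laplacian_def vec_lambda_beta
  proof (rule sum_mono)
    fix u
    show "edge_mult G u v * real_of_int (f v - f u) \<le> (if \<rho> u < \<rho> v then - edge_mult G u v else 0)"
    proof (cases "\<rho> u < \<rho> v")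
      case True
      then have "f u \<noteq> mf" using v(2)[of u] by auto
      then have "f v - f u \<le> -1" using mf[of u] v(1) by linarith
      then have "real_of_int (f v - f u) \<le> -1" by linarith
      then have "edge_mult G u v * real_of_int (f v - f u) \<le> edge_mult G u v * (-1)"
        by (intro mult_left_mono) auto
      then show ?thesis using True by simp
    next
      case False
      then show ?thesis using mf[of u] v(1) by (simp add: mult_nonneg_nonpos)
    qed
  qed
  also have "\<dots> = - (\<Sum>u | \<rho> u < \<rho> v. edge_mult G u v)" by (simp add: sum.If_cases sum_negf)
  finally have "order_divisor G \<rho> $ v + laplacian G f $ v < 0" by (simp add: order_divisor_def)
  then show "\<exists>v. order_divisor G \<rho> $ v + laplacian G f $ v < 0" by blast
qed

text \<open>
  The integral divisors of degree \<open>g - 1\<close> without effective representative.  They turn out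
  to be those of rank \<open>-1\<close>; in this form they can be used to compute the rank.
\<close>

definition moderators :: "'v::finite multigraph \<Rightarrow> 'v rdivisor set" where
  "moderators G = {\<nu>. is_divisor \<nu> \<and> deg \<nu> = of_int (genus G - 1) \<and> linear_system G \<nu> = {}}"

lemma linear_system_empty_translate:
  assumes "linear_system G D = {}" shows "linear_system G (D + laplacian G f) = {}"
proof -
  have "\<exists>v. (D + laplacian G f) $ v + laplacian G h $ v < 0" for h
    using assms laplacian_add[of G f h] unfolding linear_system_empty_iff
    by (metis vector_add_component add.assoc)
  then show ?thesis by (simp add: linear_system_empty_iff)
qed

lemma moderators_translate:
  assumes "\<nu> \<in> moderators G" shows "\<nu> + laplacian G f \<in> moderators G"
  using assms linear_system_empty_translate[of G \<nu> f] is_divisor_laplacian[of G f]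
  by (simp add: moderators_def deg_add deg_laplacian is_divisor_def)

lemma order_divisor_mem_moderators:
  fixes \<rho> :: "'v::finite \<Rightarrow> nat"
  assumes "loopless G" "inj \<rho>" shows "order_divisor G \<rho> \<in> moderators G"
  using assms by (simp add: moderators_def is_divisor_order_divisor deg_order_divisor linear_system_order_divisor
      del: of_int_diff)

lemma moderators_nonempty:
  fixes G :: "'v::finite multigraph"
  assumes "loopless G" shows "moderators G \<noteq> {}"
proof -
  obtain \<rho> :: "'v \<Rightarrow> nat" where "inj \<rho>"
    using finite_imp_inj_to_nat_seg[of "UNIV :: 'v set"] by auto
  then show ?thesis using order_divisor_mem_moderators[OF assms] by blast
qed

lemma divisor_le_moderator:
  fixes G :: "'v::finite multigraph"
  assumes "loopless G" "graph_connected G" "is_divisor D" "linear_system G D = {}"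
  obtains \<nu> where "\<nu> \<in> moderators G" "\<And>v. D $ v \<le> \<nu> $ v"
proof -
  obtain f where f: "\<And>A. A \<noteq> {} \<Longrightarrow>
      \<exists>v\<in>A. (D - laplacian G f) $ v + 1 \<le> (\<Sum>u\<in>-A. edge_mult G u v)"
    using exists_reduced_divisor[OF assms(2-4)] by metis
  obtain \<rho> :: "'v \<Rightarrow> nat" where \<rho>: "inj \<rho>"
      and le: "\<And>v. (D - laplacian G f) $ v + 1 \<le> (\<Sum>u | \<rho> u < \<rho> v. edge_mult G u v)"
    using burning_order[OF f] by blast
  show ?thesis
  proof
    show "order_divisor G \<rho> + laplacian G f \<in> moderators G"
      by (intro moderators_translate order_divisor_mem_moderators assms \<rho>)
    show "D $ v \<le> (order_divisor G \<rho> + laplacian G f) $ v" for v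
      using le[of v] by (simp add: order_divisor_def)
  qed
qed

text \<open>
  For real divisors the bound is the strict one by \<open>\<nu> + 1\<close>, since whether \<open>|D|\<close> is
  empty depends only on the integer parts of the coefficients of \<open>D\<close>.
\<close>

lemma linear_system_empty_iff_moderator:
  fixes G :: "'v::finite multigraph"
  assumes "loopless G" "graph_connected G"
  shows "linear_system G D = {} \<longleftrightarrow> (\<exists>\<nu>\<in>moderators G. \<forall>v. D $ v < \<nu> $ v + 1)"
proof
  assume D: "linear_system G D = {}"
  let ?D = "\<chi> v. real_of_int \<lfloor>D $ v\<rfloor>"
  have "linear_system G ?D = {}"
    unfolding linear_system_empty_iff
  proof
    fix f
    from D obtain v where "D $ v + laplacian G f $ v < 0" unfolding linear_system_empty_iff by blast
    then have "?D $ v + laplacian G f $ v < 0"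
      using of_int_floor_le[of "D $ v"] unfolding vec_lambda_beta by linarith
    then show "\<exists>v. ?D $ v + laplacian G f $ v < 0" by blast
  qed
  moreover have "is_divisor ?D" by (simp add: is_divisor_def)
  ultimately obtain \<nu> where \<nu>: "\<nu> \<in> moderators G" "\<And>v. ?D $ v \<le> \<nu> $ v"
    using divisor_le_moderator[OF assms] by metis
  have "D $ v < \<nu> $ v + 1" for v
    using \<nu>(2)[of v] real_of_int_floor_add_one_gt[of "D $ v"] unfolding vec_lambda_beta by linarith
  then show "\<exists>\<nu>\<in>moderators G. \<forall>v. D $ v < \<nu> $ v + 1" using \<nu>(1) by blast
next
  assume "\<exists>\<nu>\<in>moderators G. \<forall>v. D $ v < \<nu> $ v + 1"
  then obtain \<nu> where \<nu>: "is_divisor \<nu>" "linear_system G \<nu> = {}" and lt: "\<And>v. D $ v < \<nu> $ v + 1"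
    by (auto simp: moderators_def)
  show "linear_system G D = {}"
    unfolding linear_system_empty_iff
  proof
    fix f
    from \<nu>(2) obtain v where v: "\<nu> $ v + laplacian G f $ v < 0" unfolding linear_system_empty_iff by blast
    have "\<nu> $ v + laplacian G f $ v \<in> \<int>"
      using \<nu>(1) is_divisor_laplacian[of G f] by (simp add: is_divisor_def)
    from Ints_less_add1[OF this Ints_0 v] have "D $ v + laplacian G f $ v < 0" using lt[of v] by simp
    then show "\<exists>v. D $ v + laplacian G f $ v < 0" by blast
  qed
qed

section \<open>The rank as an excess over the moderators\<close>

text \<open>
  The degree of the positive part, written \<open>deg\<^sup>+\<close> in the literature.
\<close>

definition pos_deg :: "real ^ 'v::finite \<Rightarrow> real" where
  "pos_deg x = (\<Sum>v\<in>UNIV. max 0 (x $ v))"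

lemma pos_deg_nonneg: "0 \<le> pos_deg x"
  by (simp add: pos_deg_def sum_nonneg)

lemma pos_deg_mono: "(\<And>v. x $ v \<le> y $ v) \<Longrightarrow> pos_deg x \<le> pos_deg y"
  unfolding pos_deg_def by (rule sum_mono) (rule max.mono, auto)

lemma pos_deg_minus: "pos_deg (- x) = pos_deg x - deg x"
  unfolding pos_deg_def deg_def sum_subtractf[symmetric] by (rule sum.cong) auto

lemma pos_deg_add_vec:
  fixes x :: "real ^ 'v::finite"
  assumes "0 \<le> c"
  shows "pos_deg (x + vec c) \<le> pos_deg x + real CARD('v) * c"
proof -
  have "pos_deg (x + vec c) \<le> (\<Sum>v\<in>UNIV. max 0 (x $ v) + c)"
    unfolding pos_deg_def using assms by (intro sum_mono) auto
  then show ?thesis by (simp add: pos_deg_def sum.distrib)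
qed

lemma pos_deg_vec: "pos_deg (vec c :: real ^ 'v::finite) = real CARD('v) * max 0 c"
  by (simp add: pos_deg_def)

lemma pos_deg_lipschitz:
  fixes x y :: "real ^ 'v::finite"
  shows "pos_deg x \<le> pos_deg y + real CARD('v) * dist x y"
proof -
  have "pos_deg x \<le> pos_deg (y + vec (dist x y))"
  proof (rule pos_deg_mono)
    fix v
    have "\<bar>(x - y) $ v\<bar> \<le> dist x y" unfolding dist_norm by (rule component_le_norm_cart)
    then show "x $ v \<le> (y + vec (dist x y)) $ v" by simp
  qed
  also have "\<dots> \<le> pos_deg y + real CARD('v) * dist x y" by (rule pos_deg_add_vec) simp
  finally show ?thesis .
qed

text \<open>
  The least positive degree by which \<open>x\<close> exceeds a point of \<open>T\<close>.  The infimum is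
  meant for nonempty \<open>T\<close>.
\<close>

definition excess :: "(real ^ 'v::finite) set \<Rightarrow> real ^ 'v \<Rightarrow> real" where
  "excess T x = (INF t\<in>T. pos_deg (x - t))"

lemma excess_le: "t \<in> T \<Longrightarrow> excess T x \<le> pos_deg (x - t)"
  unfolding excess_def by (rule cINF_lower) (auto intro: pos_deg_nonneg)

lemma excess_ge_iff: "T \<noteq> {} \<Longrightarrow> c \<le> excess T x \<longleftrightarrow> (\<forall>t\<in>T. c \<le> pos_deg (x - t))"
  unfolding excess_def by (rule le_cINF_iff) (auto intro: pos_deg_nonneg)

lemma excess_less_iff: "T \<noteq> {} \<Longrightarrow> excess T x < c \<longleftrightarrow> (\<exists>t\<in>T. pos_deg (x - t) < c)"
  using excess_ge_iff[of T c x] by (auto simp: not_le[symmetric])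

lemma excess_mono:
  assumes "T \<noteq> {}" "\<And>v. x $ v \<le> y $ v" shows "excess T x \<le> excess T y"
  unfolding excess_ge_iff[OF assms(1)]
proof
  fix t assume "t \<in> T"
  then have "excess T x \<le> pos_deg (x - t)" by (rule excess_le)
  also have "\<dots> \<le> pos_deg (y - t)" using assms(2) by (intro pos_deg_mono) simp
  finally show "excess T x \<le> pos_deg (y - t)" .
qed

lemma continuous_on_excess:
  fixes T :: "(real ^ 'v::finite) set"
  assumes "T \<noteq> {}" shows "continuous_on S (excess T)"
proof -
  have *: "excess T x \<le> excess T y + real CARD('v) * dist x y" for x y
  proof -
    have "\<forall>t\<in>T. excess T x - real CARD('v) * dist x y \<le> pos_deg (y - t)"
    proof
      fix t assume "t \<in> T"
      then have "excess T x \<le> pos_deg (x - t)" by (rule excess_le)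
      also have "\<dots> \<le> pos_deg (y - t) + real CARD('v) * dist (x - t) (y - t)" by (rule pos_deg_lipschitz)
      finally show "excess T x - real CARD('v) * dist x y \<le> pos_deg (y - t)" by (simp add: dist_norm)
    qed
    then show ?thesis using excess_ge_iff[OF assms] by (metis diff_le_eq)
  qed
  have "(real CARD('v))-lipschitz_on UNIV (excess T)"
  proof (rule lipschitz_onI)
    fix x y
    show "dist (excess T x) (excess T y) \<le> real CARD('v) * dist x y"
      using *[of x y] *[of y x] by (simp add: dist_real_def dist_commute abs_le_iff)
  qed simp
  then show ?thesis using lipschitz_on_continuous_on continuous_on_subset by blast
qed

lemma excess_translate:
  assumes ne: "T \<noteq> {}" and tr: "\<And>t f. t \<in> T \<Longrightarrow> t + laplacian G f \<in> T"
  shows "excess T (x - laplacian G f) = excess T x"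
proof (rule antisym)
  have tr': "t - laplacian G f \<in> T" if "t \<in> T" for t
    using tr[OF that, of "\<lambda>v. - f v"] by (simp add: laplacian_minus)
  show "excess T (x - laplacian G f) \<le> excess T x"
    unfolding excess_ge_iff[OF ne]
    using excess_le[OF tr', of _ "x - laplacian G f"] by (simp add: algebra_simps)
  show "excess T x \<le> excess T (x - laplacian G f)"
    unfolding excess_ge_iff[OF ne]
    using excess_le[OF tr, of _ x] by (simp add: algebra_simps)
qed

lemma continuous_on_deg: "continuous_on S (deg :: real ^ 'v::finite \<Rightarrow> real)"
  unfolding deg_def by (intro continuous_intros)

lemma excess_attains_max:
  fixes G :: "'v::finite multigraph" and T :: "(real ^ 'v) set"
  assumes conn: "graph_connected G" and ne: "T \<noteq> {}"
    and tr: "\<And>t f. t \<in> T \<Longrightarrow> t + laplacian G f \<in> T"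
  obtains x where "deg x = e" "\<And>y. deg y = e \<Longrightarrow> excess T y \<le> excess T x"
proof -
  obtain B where B: "\<And>p. deg p = 0 \<Longrightarrow> \<exists>f. \<forall>v. \<bar>p $ v - laplacian G f $ v\<bar> \<le> B"
    using laplacian_rounding[OF conn] by metis
  define c where "c = e / real CARD('v)"
  define K where "K = {x. deg x = e} \<inter> cbox (vec (c - B)) (vec (c + B) :: real ^ 'v)"
  have red: "\<exists>f. y - laplacian G f \<in> K" if "deg y = e" for y
  proof -
    have "deg (y - vec c) = 0" using that by (simp add: deg_diff deg_vec c_def)
    from B[OF this] obtain f where f: "\<And>v. \<bar>(y - vec c) $ v - laplacian G f $ v\<bar> \<le> B" by blast
    have "c - B \<le> (y - laplacian G f) $ v \<and> (y - laplacian G f) $ v \<le> c + B" for v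
      using f[of v] by (simp add: abs_le_iff)
    then show ?thesis using that by (auto simp: K_def deg_diff deg_laplacian mem_box_cart)
  qed
  have "deg (vec c :: real ^ 'v) = e" by (simp add: deg_vec c_def)
  from red[OF this] have "K \<noteq> {}" by blast
  moreover have "compact K" unfolding K_def
    by (intro closed_Int_compact closed_Collect_eq continuous_on_deg continuous_on_const compact_cbox)
  ultimately obtain x where x: "x \<in> K" "\<forall>y\<in>K. excess T y \<le> excess T x"
    using continuous_attains_sup[OF _ _ continuous_on_excess[OF ne]] by blast
  show ?thesis
  proof
    show "deg x = e" using x(1) by (simp add: K_def)
    fix y :: "real ^ 'v" assume "deg y = e"
    from red[OF this] obtain f where "y - laplacian G f \<in> K" by blast
    with x(2) show "excess T y \<le> excess T x" using excess_translate[OF ne tr] by metis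
  qed
qed

lemma div_rank_eq_excess:
  fixes G :: "'v::finite multigraph"
  assumes G: "loopless G" "graph_connected G"
  shows "div_rank G D = excess (moderators G) D - 1"
proof -
  let ?N = "moderators G"
  have ne: "?N \<noteq> {}" by (rule moderators_nonempty[OF G(1)])
  have one: "(\<Sum>v\<in>UNIV. axis v 1 :: real ^ 'v) = vec 1"
    by (simp add: vec_eq_iff axis_def sum.delta')
  define K where "K = {k. \<exists>E. effective E \<and> deg E = k \<and> linear_system G (D + vec 1 - E) = {}}"
  have K_ge: "excess ?N D \<le> k" if k: "k \<in> K" for k
  proof -
    obtain E where E: "effective E" "deg E = k" "linear_system G (D + vec 1 - E) = {}"
      using k unfolding K_def by blast
    obtain \<nu> where \<nu>: "\<nu> \<in> ?N" "\<And>v. (D + vec 1 - E) $ v < \<nu> $ v + 1"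
      using E(3) unfolding linear_system_empty_iff_moderator[OF G] by blast
    have "excess ?N D \<le> pos_deg (D - \<nu>)" by (rule excess_le[OF \<nu>(1)])
    also have "\<dots> \<le> deg E" unfolding pos_deg_def deg_def
    proof (rule sum_mono)
      fix v
      show "max 0 ((D - \<nu>) $ v) \<le> E $ v" using \<nu>(2)[of v] E(1) by (simp add: effective_def)
    qed
    finally show ?thesis using E(2) by simp
  qed
  have K_mem: "pos_deg (D - \<nu>) + real CARD('v) * \<epsilon> \<in> K" if "\<nu> \<in> ?N" "\<epsilon> > 0" for \<nu> \<epsilon>
  proof -
    let ?E = "\<chi> v. max 0 ((D - \<nu>) $ v) + \<epsilon>"
    have "effective ?E" using that(2) by (simp add: effective_def add_nonneg_nonneg)
    moreover have "deg ?E = pos_deg (D - \<nu>) + real CARD('v) * \<epsilon>"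
      by (simp add: deg_def pos_deg_def sum.distrib)
    moreover have "\<forall>v. (D + vec 1 - ?E) $ v < \<nu> $ v + 1" using that(2) by (auto simp: max_def)
    then have "linear_system G (D + vec 1 - ?E) = {}"
      unfolding linear_system_empty_iff_moderator[OF G] using that(1) by blast
    ultimately show ?thesis unfolding K_def by blast
  qed
  have Kne: "K \<noteq> {}" using K_mem[of _ 1] ne by force
  have bdd: "bdd_below K" using K_ge by (rule bdd_belowI)
  have "Inf K = excess ?N D"
  proof (rule antisym)
    show "excess ?N D \<le> Inf K" by (rule cInf_greatest[OF Kne K_ge])
    show "Inf K \<le> excess ?N D" unfolding excess_ge_iff[OF ne]
    proof
      fix \<nu> assume \<nu>: "\<nu> \<in> ?N"
      show "Inf K \<le> pos_deg (D - \<nu>)"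
      proof (rule field_le_epsilon)
        fix e :: real assume "e > 0"
        then have "pos_deg (D - \<nu>) + real CARD('v) * (e / real CARD('v)) \<in> K"
          by (intro K_mem[OF \<nu>]) simp
        from cInf_lower[OF this bdd] show "Inf K \<le> pos_deg (D - \<nu>) + e" by simp
      qed
    qed
  qed
  then show ?thesis by (simp add: div_rank_def modified_rank_def one K_def)
qed

lemma nonspecial_eq_moderators:
  fixes G :: "'v::finite multigraph"
  assumes G: "loopless G" "graph_connected G"
  shows "nonspecial G = moderators G"
proof -
  have ne: "moderators G \<noteq> {}" by (rule moderators_nonempty[OF G(1)])
  have "div_rank G D = -1 \<longleftrightarrow> linear_system G D = {}"
    if int: "is_divisor D" and deg: "deg D = of_int (genus G - 1)" for D
  proof
    assume "div_rank G D = -1"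
    then have "excess (moderators G) D < 1" by (simp add: div_rank_eq_excess[OF G])
    then obtain \<nu> where \<nu>: "\<nu> \<in> moderators G" "pos_deg (D - \<nu>) < 1"
      unfolding excess_less_iff[OF ne] by blast
    have "D $ v < \<nu> $ v + 1" for v
    proof -
      have "max 0 ((D - \<nu>) $ v) \<le> pos_deg (D - \<nu>)"
        unfolding pos_deg_def by (rule member_le_sum) auto
      then show ?thesis using \<nu>(2) by simp
    qed
    then show "linear_system G D = {}" unfolding linear_system_empty_iff_moderator[OF G] using \<nu>(1) by blast
  next
    assume "linear_system G D = {}"
    then have "D \<in> moderators G" using int deg by (simp add: moderators_def)
    then have "excess (moderators G) D \<le> 0" using excess_le[of D "moderators G" D] by (simp add: pos_deg_def)
    moreover have "0 \<le> excess (moderators G) D" using ne by (simp add: excess_ge_iff pos_deg_nonneg)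
    ultimately show "div_rank G D = -1" by (simp add: div_rank_eq_excess[OF G])
  qed
  then show ?thesis by (auto simp: nonspecial_def moderators_def)
qed

section \<open>Distances with respect to the mixed polytope\<close>

lemma simplex_vertex_nth:
  "simplex_vertex i $ j = (if j = i then real CARD('v) - 1 else -1)" for i j :: "'v::finite"
proof -
  have "(\<Sum>k\<in>UNIV - {i}. axis k 1 $ j) = (\<Sum>k\<in>UNIV - {i}. if k = j then 1 else 0 :: real)"
    by (rule sum.cong) (auto simp: axis_def)
  then show ?thesis by (simp add: simplex_vertex_def axis_def)
qed

lemma std_simplex_eq: "std_simplex = {x :: real ^ 'v::finite. deg x = 0 \<and> (\<forall>i. -1 \<le> x $ i)}"
  (is "_ = ?S")
proof
  have "convex ?S" unfolding convex_def
  proof (intro ballI allI impI)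
    fix x y :: "real ^ 'v" and u w :: real
    assume *: "x \<in> ?S" "y \<in> ?S" "0 \<le> u" "0 \<le> w" "u + w = 1"
    have "-1 \<le> (u *\<^sub>R x + w *\<^sub>R y) $ i" for i
    proof -
      have "u * (-1) + w * (-1) \<le> u * x $ i + w * y $ i"
        using * by (intro add_mono mult_left_mono) auto
      then show ?thesis using *(5) by simp
    qed
    then show "u *\<^sub>R x + w *\<^sub>R y \<in> ?S" using * by (simp add: deg_add deg_scaleR)
  qed
  moreover have "range simplex_vertex \<subseteq> ?S"
  proof -
    have "deg (simplex_vertex i :: real ^ 'v) = 0" for i
    proof -
      have "deg (simplex_vertex i :: real ^ 'v) = (\<Sum>j\<in>UNIV. (if j = i then real CARD('v) else 0) - 1)"
        unfolding deg_def by (rule sum.cong) (auto simp: simplex_vertex_nth)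
      then show ?thesis by (simp add: sum_subtractf)
    qed
    then show ?thesis by (auto simp: simplex_vertex_nth)
  qed
  ultimately show "std_simplex \<subseteq> ?S" unfolding std_simplex_def by (intro hull_minimal)
  show "?S \<subseteq> std_simplex"
  proof
    fix x :: "real ^ 'v" assume x: "x \<in> ?S"
    define a where "a i = (x $ i + 1) / real CARD('v)" for i
    have sum_a: "(\<Sum>i\<in>UNIV. a i) = 1"
      using x by (simp add: a_def deg_def sum_divide_distrib[symmetric] sum.distrib)
    have "0 \<le> x $ i + 1" for i
    proof -
      have "-1 \<le> x $ i" using x by blast
      then show ?thesis by linarith
    qed
    then have a_nonneg: "0 \<le> a i" for i by (simp add: a_def)
    have "x = (\<Sum>i\<in>UNIV. a i *\<^sub>R simplex_vertex i)"
    proof (subst vec_eq_iff, rule allI)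
      fix j
      have "(\<Sum>i\<in>UNIV. a i *\<^sub>R simplex_vertex i) $ j
          = (\<Sum>i\<in>UNIV. (if i = j then real CARD('v) * a j else 0) - a i)"
        by (simp add: simplex_vertex_nth) (rule sum.cong, auto simp: algebra_simps)
      also have "\<dots> = real CARD('v) * a j - 1" by (simp add: sum_subtractf sum_a)
      also have "\<dots> = x $ j" by (simp add: a_def)
      finally show "x $ j = (\<Sum>i\<in>UNIV. a i *\<^sub>R simplex_vertex i) $ j" by simp
    qed
    also have "\<dots> \<in> std_simplex" unfolding std_simplex_def
      using sum_a a_nonneg by (intro convex_sum) (auto simp: hull_inc)
    finally show "x \<in> std_simplex" .
  qed
qed

text \<open>
  Writing \<open>p - t = \<mu>(\<kappa>w - y)\<close> with \<open>w\<close> and \<open>y\<close> in the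
  simplex, the vector \<open>p - t - \<mu>(1 - \<kappa>)\<close> becomes the difference of the nonnegative vectors
  \<open>\<mu>\<kappa>(w + 1)\<close> and \<open>\<mu>(y + 1)\<close>, of degrees \<open>n\<mu>\<kappa>\<close> and
  \<open>n\<mu>\<close>.
\<close>

lemma mem_scaled_poly_P_iff:
  fixes p t :: "real ^ 'v::finite"
  assumes eq: "deg p = deg t" and "0 < \<kappa>" "0 \<le> \<mu>"
  shows "t \<in> (\<lambda>x. p + \<mu> *\<^sub>R x) ` poly_P 1 \<kappa> \<longleftrightarrow>
    pos_deg (p - t - vec (\<mu> * (1 - \<kappa>))) \<le> real CARD('v) * (\<mu> * \<kappa>)"
    (is "?L \<longleftrightarrow> pos_deg ?z \<le> _")
proof
  assume ?L
  then obtain y w :: "real ^ 'v" where y: "y \<in> std_simplex" and w: "w \<in> std_simplex"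
    and t: "t = p + \<mu> *\<^sub>R (y - \<kappa> *\<^sub>R w)"
    by (auto simp: poly_P_def opp_simplex_def)
  have "pos_deg ?z \<le> (\<Sum>i\<in>UNIV. (\<mu> * \<kappa>) * (w $ i + 1))"
    unfolding pos_deg_def
  proof (rule sum_mono)
    fix i
    have "?z $ i = (\<mu> * \<kappa>) * (w $ i + 1) - \<mu> * (y $ i + 1)" by (simp add: t algebra_simps)
    moreover have "0 \<le> \<mu> * (y $ i + 1)" "0 \<le> (\<mu> * \<kappa>) * (w $ i + 1)"
    proof -
      have "-1 \<le> y $ i" "-1 \<le> w $ i" using y w by (auto simp: std_simplex_eq)
      then show "0 \<le> \<mu> * (y $ i + 1)" "0 \<le> (\<mu> * \<kappa>) * (w $ i + 1)" using assms
        by (simp_all add: mult_nonneg_nonneg)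
    qed
    ultimately show "max 0 (?z $ i) \<le> (\<mu> * \<kappa>) * (w $ i + 1)" by simp
  qed
  also have "\<dots> = (\<mu> * \<kappa>) * (deg w + real CARD('v))"
    by (simp add: deg_def sum_distrib_left[symmetric] sum.distrib)
  also have "\<dots> = real CARD('v) * (\<mu> * \<kappa>)" using w by (simp add: std_simplex_eq)
  finally show "pos_deg ?z \<le> real CARD('v) * (\<mu> * \<kappa>)" .
next
  assume le: "pos_deg ?z \<le> real CARD('v) * (\<mu> * \<kappa>)"
  have zero: "(0 :: real ^ 'v) \<in> std_simplex" by (simp add: std_simplex_eq deg_def)
  show ?L
  proof (cases "\<mu> = 0")
    case True
    have "?z = p - t" using True by (simp add: vec_eq_iff)
    then have 0: "pos_deg (p - t) \<le> 0" using le True by simp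
    moreover have "deg (p - t) = 0" using eq by (simp add: deg_diff)
    ultimately have "pos_deg (p - t) = 0" "pos_deg (t - p) = 0"
      using pos_deg_minus[of "p - t"] pos_deg_nonneg[of "p - t"] by auto
    then have "max 0 ((p - t) $ i) = 0 \<and> max 0 ((t - p) $ i) = 0" for i
      unfolding pos_deg_def by (simp add: sum_nonneg_eq_0_iff)
    then have "t = p" by (force simp: vec_eq_iff max_def split: if_splits)
    moreover have "poly_P 1 \<kappa> \<noteq> ({} :: (real ^ 'v) set)"
      using zero by (auto simp: poly_P_def opp_simplex_def)
    ultimately show ?thesis using True by auto
  next
    case False
    then have \<mu>: "\<mu> > 0" using assms by simp
    \<comment> \<open>The slack in the inequality is spread evenly over positive and negative parts.\<close>
    define s where "s = (real CARD('v) * (\<mu> * \<kappa>) - pos_deg ?z) / real CARD('v)"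
    have s: "0 \<le> s" "real CARD('v) * s = real CARD('v) * (\<mu> * \<kappa>) - pos_deg ?z"
      using le by (simp_all add: s_def)
    define w :: "real ^ 'v" where "w = (\<chi> i. (max 0 (?z $ i) + s) / (\<mu> * \<kappa>) - 1)"
    define y :: "real ^ 'v" where "y = (\<chi> i. (max 0 ((- ?z) $ i) + s) / \<mu> - 1)"
    have "deg w = (pos_deg ?z + real CARD('v) * s) / (\<mu> * \<kappa>) - real CARD('v)"
      by (simp add: deg_def w_def pos_deg_def sum_subtractf sum_divide_distrib[symmetric] sum.distrib)
    then have degw: "deg w = 0" using s(2) \<mu> assms by simp
    have "deg y = (pos_deg (- ?z) + real CARD('v) * s) / \<mu> - real CARD('v)"
      by (simp add: deg_def y_def pos_deg_def sum_subtractf sum_divide_distrib[symmetric] sum.distrib)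
    also have "pos_deg (- ?z) + real CARD('v) * s = real CARD('v) * \<mu>"
    proof -
      have "deg ?z = real CARD('v) * (\<mu> * \<kappa>) - real CARD('v) * \<mu>"
        using eq by (simp add: deg_diff deg_vec) (simp add: algebra_simps)
      then show ?thesis using s(2) pos_deg_minus[of ?z] by linarith
    qed
    finally have degy: "deg y = 0" using \<mu> by simp
    have "w \<in> std_simplex" "y \<in> std_simplex"
      using degw degy s(1) \<mu> assms by (auto simp: std_simplex_eq w_def y_def intro!: divide_nonneg_nonneg add_nonneg_nonneg)
    moreover have "t = p + \<mu> *\<^sub>R (1 *\<^sub>R y + \<kappa> *\<^sub>R (- w))"
    proof (subst vec_eq_iff, rule allI)
      fix i
      have "\<mu> * y $ i = max 0 (- ?z $ i) + s - \<mu>" using \<mu> by (simp add: y_def right_diff_distrib)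
      moreover have "\<mu> * (\<kappa> * w $ i) = max 0 (?z $ i) + s - \<mu> * \<kappa>"
      proof -
        have "(\<mu> * \<kappa>) * w $ i = max 0 (?z $ i) + s - \<mu> * \<kappa>"
          using \<mu> assms unfolding w_def vec_lambda_beta by (subst right_diff_distrib) simp
        then show ?thesis by (simp add: mult.assoc)
      qed
      moreover have "max 0 (- ?z $ i) - max 0 (?z $ i) = - (p $ i - t $ i - \<mu> * (1 - \<kappa>))" by auto
      ultimately show "t $ i = (p + \<mu> *\<^sub>R (1 *\<^sub>R y + \<kappa> *\<^sub>R (- w))) $ i"
        by (simp add: algebra_simps)
    qed
    ultimately show ?thesis unfolding poly_P_def opp_simplex_def by blast
  qed
qed

lemma conv_dist_poly_P:
  fixes p t :: "real ^ 'v::finite"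
  assumes "deg p = deg t" and "0 < \<kappa>"
  shows "conv_dist (poly_P 1 \<kappa>) p t =
    Inf {\<mu>. 0 \<le> \<mu> \<and> pos_deg (p - t - vec (\<mu> * (1 - \<kappa>))) \<le> real CARD('v) * (\<mu> * \<kappa>)}"
  unfolding conv_dist_def using mem_scaled_poly_P_iff[OF assms] by (intro arg_cong[of _ _ Inf]) auto

lemma bdd_below_nonneg_Collect: "bdd_below {\<mu>::real. 0 \<le> \<mu> \<and> P \<mu>}"
  by (rule bdd_belowI[of _ 0]) auto

lemma conv_dist_poly_P_le:
  fixes p t :: "real ^ 'v::finite"
  assumes "deg p = deg t" "0 < \<kappa>" "0 \<le> \<mu>"
    and "pos_deg (p - t - vec (\<mu> * (1 - \<kappa>))) \<le> real CARD('v) * (\<mu> * \<kappa>)"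
  shows "conv_dist (poly_P 1 \<kappa>) p t \<le> \<mu>"
  unfolding conv_dist_poly_P[OF assms(1,2)]
  by (rule cInf_lower[OF _ bdd_below_nonneg_Collect]) (use assms in auto)

text \<open>
  An admissible scaling factor, which makes the set defining the distance nonempty.
\<close>

lemma conv_dist_poly_P_witness:
  fixes p t :: "real ^ 'v::finite"
  assumes "0 < \<kappa>" and \<mu>_eq: "\<mu> = pos_deg (p - t) / (real CARD('v) * min 1 \<kappa>)"
  shows "pos_deg (p - t - vec (\<mu> * (1 - \<kappa>))) \<le> real CARD('v) * (\<mu> * \<kappa>)"
proof -
  have n: "real CARD('v) > 0" by simp
  have eq: "pos_deg (p - t) = real CARD('v) * \<mu> * min 1 \<kappa>" using assms n by (simp add: field_simps)
  have \<mu>: "0 \<le> \<mu>" using assms pos_deg_nonneg[of "p - t"] by simp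
  show ?thesis
  proof (cases "\<kappa> \<le> 1")
    case True
    then have "0 \<le> \<mu> * (1 - \<kappa>)" using \<mu> by simp
    then have "pos_deg (p - t - vec (\<mu> * (1 - \<kappa>))) \<le> pos_deg (p - t)"
      by (intro pos_deg_mono) simp
    then show ?thesis using eq True by (simp add: mult.assoc min_def)
  next
    case False
    have "p - t - vec (\<mu> * (1 - \<kappa>)) = p - t + vec (\<mu> * (\<kappa> - 1))"
      by (simp add: vec_eq_iff algebra_simps)
    also have "pos_deg \<dots> \<le> pos_deg (p - t) + real CARD('v) * (\<mu> * (\<kappa> - 1))"
      using False \<mu> by (intro pos_deg_add_vec) simp
    finally show ?thesis using eq False by (simp add: algebra_simps min_def)
  qed
qed

text \<open>
  The inequality defining the admissible \<open>\<mu>\<close> gets strictly slacker as \<open>\<mu>\<close>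
  grows, so no smaller factor is admissible when the reverse inequality holds at \<open>\<mu>\<close>.
\<close>

lemma conv_dist_poly_P_ge:
  fixes p t :: "real ^ 'v::finite"
  assumes eq: "deg p = deg t" and \<kappa>: "0 < \<kappa>"
    and ge: "real CARD('v) * (\<mu> * \<kappa>) \<le> pos_deg (p - t - vec (\<mu> * (1 - \<kappa>)))"
  shows "\<mu> \<le> conv_dist (poly_P 1 \<kappa>) p t"
  unfolding conv_dist_poly_P[OF eq \<kappa>]
proof (rule cInf_greatest)
  let ?S = "{\<mu>. 0 \<le> \<mu> \<and> pos_deg (p - t - vec (\<mu> * (1 - \<kappa>))) \<le> real CARD('v) * (\<mu> * \<kappa>)}"
  have "pos_deg (p - t) / (real CARD('v) * min 1 \<kappa>) \<in> ?S"
    using conv_dist_poly_P_witness[OF \<kappa> refl] pos_deg_nonneg[of "p - t"] \<kappa> by simp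
  then show "?S \<noteq> {}" by blast
  fix \<mu>' assume "\<mu>' \<in> ?S"
  then have le: "pos_deg (p - t - vec (\<mu>' * (1 - \<kappa>))) \<le> real CARD('v) * (\<mu>' * \<kappa>)" by simp
  have n: "real CARD('v) > 0" by simp
  show "\<mu> \<le> \<mu>'"
  proof (rule ccontr)
    assume "\<not> \<mu> \<le> \<mu>'"
    then have lt: "\<mu>' < \<mu>" by simp
    show False
    proof (cases "\<kappa> \<le> 1")
      case True
      have "\<mu>' * (1 - \<kappa>) \<le> \<mu> * (1 - \<kappa>)" using lt True by (intro mult_right_mono) auto
      then have "pos_deg (p - t - vec (\<mu> * (1 - \<kappa>))) \<le> pos_deg (p - t - vec (\<mu>' * (1 - \<kappa>)))"
        by (intro pos_deg_mono) simp
      moreover have "real CARD('v) * (\<mu>' * \<kappa>) < real CARD('v) * (\<mu> * \<kappa>)" using lt \<kappa> by simp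
      ultimately show False using ge le by linarith
    next
      case False
      have "p - t - vec (\<mu> * (1 - \<kappa>)) = p - t - vec (\<mu>' * (1 - \<kappa>)) + vec ((\<mu> - \<mu>') * (\<kappa> - 1))"
        by (simp add: vec_eq_iff algebra_simps)
      also have "pos_deg \<dots> \<le> pos_deg (p - t - vec (\<mu>' * (1 - \<kappa>))) + real CARD('v) * ((\<mu> - \<mu>') * (\<kappa> - 1))"
        using False lt by (intro pos_deg_add_vec) simp
      finally have "real CARD('v) * (\<mu> * \<kappa>) \<le> real CARD('v) * (\<mu>' * \<kappa>) + real CARD('v) * ((\<mu> - \<mu>') * (\<kappa> - 1))"
        using ge le by linarith
      then have "real CARD('v) * (\<mu> * \<kappa>) \<le> real CARD('v) * (\<mu>' * \<kappa> + (\<mu> - \<mu>') * (\<kappa> - 1))"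
        by (simp add: distrib_left)
      then have "\<mu> * \<kappa> \<le> \<mu>' * \<kappa> + (\<mu> - \<mu>') * (\<kappa> - 1)" using n by (subst (asm) mult_le_cancel_left_pos)
      then show False using lt by (simp add: algebra_simps)
    qed
  qed
qed

lemma conv_dist_poly_P_nonneg:
  fixes p t :: "real ^ 'v::finite"
  assumes "deg p = deg t" "0 < \<kappa>"
  shows "0 \<le> conv_dist (poly_P 1 \<kappa>) p t"
  using conv_dist_poly_P_ge[OF assms, of 0] by (simp add: pos_deg_nonneg)

text \<open>
  The covering radius is at least \<open>\<mu>\<close> iff the distance function takes a value at least
  \<open>\<mu>\<close>.  If all values were smaller, then, as the excess attains its maximum over points of a
  given degree, they would be smaller by a uniform \<open>\<epsilon>\<close>.
\<close>

lemma cov_radius_poly_P_ge_iff: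
  fixes G :: "'v::finite multigraph" and T :: "(real ^ 'v) set"
  assumes conn: "graph_connected G" and ne: "T \<noteq> {}" and T: "T \<subseteq> hyp d"
    and tr: "\<And>t f. t \<in> T \<Longrightarrow> t + laplacian G f \<in> T"
    and \<kappa>: "0 < \<kappa>" and \<mu>: "0 < \<mu>"
  shows "\<mu> \<le> cov_radius d (poly_P 1 \<kappa>) T \<longleftrightarrow>
    (\<exists>p. deg p = d \<and> real CARD('v) * (\<mu> * \<kappa>) \<le> excess T (p - vec (\<mu> * (1 - \<kappa>))))"
    (is "_ \<longleftrightarrow> ?R")
proof -
  let ?P = "poly_P 1 \<kappa> :: (real ^ 'v) set"
  let ?n = "real CARD('v)"
  have degT: "t \<in> T \<Longrightarrow> deg t = d" for t using T mem_hyp by blast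
  have hne: "hyp d \<noteq> ({} :: (real ^ 'v) set)" using T ne by auto
  have bdd: "bdd_below (conv_dist ?P p ` T)" if "deg p = d" for p
    using degT that \<kappa> by (intro bdd_belowI2[of _ 0] conv_dist_poly_P_nonneg) simp_all
  have dist_le: "dist_fun ?P T p \<le> m" if "deg p = d" "t \<in> T" "conv_dist ?P p t \<le> m" for p t m
    unfolding dist_fun_def using cINF_lower2[OF bdd] that by blast
  show ?thesis
  proof
    assume ?R
    then obtain p where p: "deg p = d" "?n * (\<mu> * \<kappa>) \<le> excess T (p - vec (\<mu> * (1 - \<kappa>)))" by blast
    have "\<mu> \<le> dist_fun ?P T p" unfolding dist_fun_def
    proof (rule cINF_greatest[OF ne])
      fix t assume t: "t \<in> T"
      have "?n * (\<mu> * \<kappa>) \<le> pos_deg (p - t - vec (\<mu> * (1 - \<kappa>)))"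
        using p(2) excess_le[OF t, of "p - vec (\<mu> * (1 - \<kappa>))"] by (simp add: algebra_simps)
      then show "\<mu> \<le> conv_dist ?P p t" using p(1) degT[OF t] \<kappa> by (intro conv_dist_poly_P_ge) auto
    qed
    also have "\<dots> \<le> cov_radius d ?P T" unfolding cov_radius_def
    proof (rule cSUP_upper)
      show "p \<in> hyp d" using p(1) by (simp add: mem_hyp)
      obtain x where x: "\<And>y. deg y = d \<Longrightarrow> excess T y \<le> excess T x"
        using excess_attains_max[OF conn ne tr] by metis
      show "bdd_above (dist_fun ?P T ` hyp d)"
      proof (rule bdd_aboveI2)
        fix q :: "real ^ 'v" assume "q \<in> hyp d"
        then have q: "deg q = d" by (simp add: mem_hyp)
        have "excess T q < excess T x + 1" using x[OF q] by simp
        then obtain t where t: "t \<in> T" "pos_deg (q - t) < excess T x + 1"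
          unfolding excess_less_iff[OF ne] by blast
        have "deg q = deg t" using q degT[OF t(1)] by simp
        then have "conv_dist ?P q t \<le> pos_deg (q - t) / (?n * min 1 \<kappa>)"
          using \<kappa> pos_deg_nonneg[of "q - t"] by (intro conv_dist_poly_P_le conv_dist_poly_P_witness) auto
        also have "\<dots> \<le> (excess T x + 1) / (?n * min 1 \<kappa>)"
          using t(2) \<kappa> by (intro divide_right_mono) auto
        finally show "dist_fun ?P T q \<le> (excess T x + 1) / (?n * min 1 \<kappa>)"
          by (rule dist_le[OF q t(1)])
      qed
    qed
    finally show "\<mu> \<le> cov_radius d ?P T" .
  next
    assume cov: "\<mu> \<le> cov_radius d ?P T"
    show ?R
    proof (rule ccontr)
      assume R: "\<not> ?R"
      let ?c = "\<mu> * (1 - \<kappa>)"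
      obtain x where x: "deg x = d - ?n * ?c"
          "\<And>y. deg y = d - ?n * ?c \<Longrightarrow> excess T y \<le> excess T x"
        using excess_attains_max[OF conn ne tr] by metis
      have "deg (x + vec ?c) = d" using x(1) by (simp add: deg_add deg_vec)
      then have lt: "excess T x < ?n * (\<mu> * \<kappa>)" using R by (force simp: not_le)
      define M where "M = (excess T x + ?n * (\<mu> * \<kappa>)) / 2"
      define \<delta> where "\<delta> = ?n * (\<mu> * \<kappa>) - M"
      have "a < b \<Longrightarrow> a < (a + b) / 2 \<and> 0 < b - (a + b) / 2" for a b :: real by auto
      from this[OF lt] have M: "excess T x < M" and \<delta>: "\<delta> > 0" by (simp_all add: \<delta>_def M_def)
      \<comment> \<open>Lowering \<open>\<mu>\<close> by \<open>\<epsilon>\<close> changes the two sides by at most \<open>n\<epsilon>|1 - \<kappa>|\<close> and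
         \<open>n\<epsilon>\<kappa>\<close>, which the slack \<open>\<delta>\<close> must cover.\<close>
      define \<epsilon> where "\<epsilon> = min \<mu> (\<delta> / (?n * (\<bar>1 - \<kappa>\<bar> + \<kappa>)))"
      have pos: "?n * (\<bar>1 - \<kappa>\<bar> + \<kappa>) > 0" using \<kappa> by (intro mult_pos_pos) auto
      have \<epsilon>: "\<epsilon> > 0" "\<epsilon> \<le> \<mu>" using \<mu> \<delta> pos by (simp_all add: \<epsilon>_def)
      have "\<epsilon> \<le> \<delta> / (?n * (\<bar>1 - \<kappa>\<bar> + \<kappa>))" by (simp add: \<epsilon>_def)
      then have \<epsilon>_le: "?n * (\<epsilon> * \<bar>1 - \<kappa>\<bar>) + ?n * (\<epsilon> * \<kappa>) \<le> \<delta>" using pos by (simp add: field_simps)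
      have "dist_fun ?P T p \<le> \<mu> - \<epsilon>" if "p \<in> hyp d" for p
      proof -
        have p: "deg p = d" using that by (simp add: mem_hyp)
        then have "excess T (p - vec ?c) \<le> excess T x" by (intro x(2)) (simp add: deg_diff deg_vec)
        with M have "excess T (p - vec ?c) < M" by linarith
        then obtain t where t: "t \<in> T" "pos_deg (p - vec ?c - t) < M"
          unfolding excess_less_iff[OF ne] by blast
        have "pos_deg (p - t - vec ((\<mu> - \<epsilon>) * (1 - \<kappa>))) \<le> pos_deg ((p - vec ?c - t) + vec (\<epsilon> * \<bar>1 - \<kappa>\<bar>))"
        proof (rule pos_deg_mono)
          fix v
          have "\<epsilon> * (1 - \<kappa>) \<le> \<epsilon> * \<bar>1 - \<kappa>\<bar>" using \<epsilon>(1) by simp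
          then show "(p - t - vec ((\<mu> - \<epsilon>) * (1 - \<kappa>))) $ v \<le> ((p - vec ?c - t) + vec (\<epsilon> * \<bar>1 - \<kappa>\<bar>)) $ v"
            by (simp add: left_diff_distrib)
        qed
        also have "\<dots> \<le> pos_deg (p - vec ?c - t) + ?n * (\<epsilon> * \<bar>1 - \<kappa>\<bar>)"
          using \<epsilon>(1) by (intro pos_deg_add_vec) simp
        also have "\<dots> \<le> M + (\<delta> - ?n * (\<epsilon> * \<kappa>))" using t(2) \<epsilon>_le by linarith
        also have "\<dots> = ?n * ((\<mu> - \<epsilon>) * \<kappa>)" by (simp add: \<delta>_def algebra_simps)
        finally have "conv_dist ?P p t \<le> \<mu> - \<epsilon>"
          using \<epsilon>(2) p degT[OF t(1)] \<kappa> by (intro conv_dist_poly_P_le) auto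
        then show ?thesis by (rule dist_le[OF p t(1)])
      qed
      then have "cov_radius d ?P T \<le> \<mu> - \<epsilon>" unfolding cov_radius_def
        by (intro cSUP_least hne) auto
      with cov \<epsilon>(1) show False by simp
    qed
  qed
qed

section \<open>Critical points of the simplex distances\<close>

text \<open>
  The distance with respect to the simplex is the largest coefficient of \<open>p - q\<close>.
\<close>

lemma
  fixes p q :: "real ^ 'v::finite"
  assumes "deg p = deg q"
  shows conv_dist_std_simplex_ge_iff:
      "s \<le> conv_dist std_simplex p q \<longleftrightarrow> (\<exists>i. s \<le> p $ i - q $ i)"
    and conv_dist_std_simplex_nonneg: "0 \<le> conv_dist std_simplex p q"
proof -
  define m where "m = Max (range (\<lambda>i. p $ i - q $ i))"
  have m_ge: "p $ i - q $ i \<le> m" for i unfolding m_def by (rule Max_ge) auto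
  have "m \<in> range (\<lambda>i. p $ i - q $ i)" unfolding m_def by (rule Max_in) auto
  then obtain k where k: "m = p $ k - q $ k" by auto
  have "0 = deg (p - q)" using assms by (simp add: deg_diff)
  also have "\<dots> \<le> (\<Sum>i\<in>(UNIV::'v set). m)" unfolding deg_def using m_ge by (intro sum_mono) simp
  finally have m0: "0 \<le> m" by (simp add: zero_le_mult_iff)
  have "{\<mu>. 0 \<le> \<mu> \<and> q \<in> (\<lambda>x. p + \<mu> *\<^sub>R x) ` std_simplex} = {m..}"
  proof (intro equalityI subsetI)
    fix \<mu> assume "\<mu> \<in> {\<mu>. 0 \<le> \<mu> \<and> q \<in> (\<lambda>x. p + \<mu> *\<^sub>R x) ` std_simplex}"
    then obtain x where x: "0 \<le> \<mu>" "x \<in> std_simplex" "q = p + \<mu> *\<^sub>R x" by blast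
    have "-1 \<le> x $ k" using x(2) by (simp add: std_simplex_eq)
    then have "\<mu> * (-1) \<le> \<mu> * x $ k" using x(1) by (intro mult_left_mono)
    then show "\<mu> \<in> {m..}" using x(3) k by simp
  next
    fix \<mu> assume "\<mu> \<in> {m..}"
    then have \<mu>: "m \<le> \<mu>" "0 \<le> \<mu>" using m0 by auto
    show "\<mu> \<in> {\<mu>. 0 \<le> \<mu> \<and> q \<in> (\<lambda>x. p + \<mu> *\<^sub>R x) ` std_simplex}"
    proof (cases "\<mu> = 0")
      case True
      then have nonneg: "0 \<le> (q - p) $ i" for i using m_ge[of i] \<mu>(1) by simp
      have "(\<Sum>i\<in>UNIV. (q - p) $ i) = 0" using assms by (simp add: deg_def sum_subtractf)
      then have "\<forall>i. (q - p) $ i = 0" using nonneg by (subst (asm) sum_nonneg_eq_0_iff) auto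
      then have "q = p" by (simp add: vec_eq_iff)
      moreover have "0 \<in> (std_simplex :: (real ^ 'v) set)" by (simp add: std_simplex_eq deg_def)
      ultimately show ?thesis using True by auto
    next
      case False
      define x where "x = (1 / \<mu>) *\<^sub>R (q - p)"
      have "deg x = 0" using assms by (simp add: x_def deg_scaleR deg_diff)
      moreover have "-1 \<le> x $ i" for i
      proof -
        have "- \<mu> \<le> (q - p) $ i" using m_ge[of i] \<mu>(1) by simp
        then show ?thesis using False \<mu>(2) by (simp add: x_def field_simps)
      qed
      ultimately have "x \<in> std_simplex" by (simp add: std_simplex_eq)
      moreover have "q = p + \<mu> *\<^sub>R x" using False by (simp add: x_def)
      ultimately show ?thesis using \<mu>(2) by blast
    qed
  qed
  then have "conv_dist std_simplex p q = m" by (simp add: conv_dist_def)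
  then show "s \<le> conv_dist std_simplex p q \<longleftrightarrow> (\<exists>i. s \<le> p $ i - q $ i)"
    and "0 \<le> conv_dist std_simplex p q" using m_ge k m0 by (metis order_trans order_refl)+
qed

lemma laplacian_lattice_uminus: "q \<in> laplacian_lattice G \<Longrightarrow> - q \<in> laplacian_lattice G"
  using laplacian_minus unfolding laplacian_lattice_def by (metis rangeE rangeI)

lemma dist_fun_std_simplex_ge_iff:
  fixes G :: "'v::finite multigraph"
  assumes G: "loopless G" "graph_connected G" and p: "deg p = 0"
  shows "s \<le> dist_fun std_simplex (laplacian_lattice G) p \<longleftrightarrow>
    (\<exists>\<nu>\<in>moderators G. \<forall>i. s \<le> \<nu> $ i + 1 + p $ i)"
proof -
  let ?L = "laplacian_lattice G"
  have degL: "q \<in> ?L \<Longrightarrow> deg q = 0" for q by (auto simp: laplacian_lattice_def deg_laplacian)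
  have "s \<le> dist_fun std_simplex ?L p \<longleftrightarrow> (\<forall>q\<in>?L. s \<le> conv_dist std_simplex p q)"
    unfolding dist_fun_def
  proof (rule le_cINF_iff)
    show "?L \<noteq> {}" by (simp add: laplacian_lattice_def)
    have "0 \<le> conv_dist std_simplex p q" if "q \<in> ?L" for q
      using p degL[OF that] by (intro conv_dist_std_simplex_nonneg) simp
    then show "bdd_below (conv_dist std_simplex p ` ?L)" by (rule bdd_belowI2)
  qed
  also have "\<dots> \<longleftrightarrow> (\<forall>q\<in>?L. \<exists>i. s \<le> p $ i - q $ i)"
    using conv_dist_std_simplex_ge_iff[of p _ s] degL p by simp
  \<comment> \<open>Integrality: a point exceeds a lattice point strictly iff its strict lower integer part
     dominates it.\<close>
  also have "\<dots> \<longleftrightarrow> linear_system G (\<chi> i. real_of_int \<lceil>s - p $ i\<rceil> - 1) = {}"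
    (is "_ \<longleftrightarrow> linear_system G ?D = {}")
  proof -
    have "s \<le> p $ i - laplacian G f $ i \<longleftrightarrow> ?D $ i + laplacian G f $ i < 0" for i f
    proof -
      have "laplacian G f $ i \<in> \<int>" using is_divisor_laplacian[of G f] by (simp add: is_divisor_def)
      then obtain k where k: "laplacian G f $ i = real_of_int k" by (auto elim: Ints_cases)
      have "?D $ i + laplacian G f $ i < 0 \<longleftrightarrow> real_of_int (\<lceil>s - p $ i\<rceil> - 1 + k) < real_of_int 0"
        by (simp add: k)
      also have "\<dots> \<longleftrightarrow> \<lceil>s - p $ i\<rceil> \<le> - k" unfolding of_int_less_iff by linarith
      also have "\<dots> \<longleftrightarrow> s \<le> p $ i - laplacian G f $ i" unfolding ceiling_le_iff k by auto
      finally show ?thesis by simp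
    qed
    then show ?thesis by (auto simp: linear_system_empty_iff laplacian_lattice_def)
  qed
  also have "\<dots> \<longleftrightarrow> (\<exists>\<nu>\<in>moderators G. \<forall>i. s \<le> \<nu> $ i + 1 + p $ i)"
  proof -
    have "?D $ i < \<nu> $ i + 1 \<longleftrightarrow> s \<le> \<nu> $ i + 1 + p $ i" if "\<nu> \<in> moderators G" for \<nu> i
    proof -
      have "\<nu> $ i \<in> \<int>" using that by (simp add: moderators_def is_divisor_def)
      then obtain k where k: "\<nu> $ i = real_of_int k" by (auto elim: Ints_cases)
      have "?D $ i < \<nu> $ i + 1 \<longleftrightarrow> real_of_int (\<lceil>s - p $ i\<rceil> - 1) < real_of_int (k + 1)"
        by (simp add: k)
      also have "\<dots> \<longleftrightarrow> \<lceil>s - p $ i\<rceil> \<le> k + 1" unfolding of_int_less_iff by linarith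
      also have "\<dots> \<longleftrightarrow> s \<le> \<nu> $ i + 1 + p $ i" unfolding ceiling_le_iff k by auto
      finally show ?thesis .
    qed
    then show ?thesis unfolding linear_system_empty_iff_moderator[OF G] by blast
  qed
  finally show ?thesis .
qed

text \<open>
  The distance function of the simplex is the upper envelope of the tent functions
  \<open>min\<^sub>i (\<nu>\<^sub>i + 1 + p\<^sub>i)\<close>, one for each moderator \<open>\<nu>\<close>.  All tents have the
  same height \<open>1 + c\<close>, because all moderators have the same degree \<open>nc\<close>, and they
  peak at \<open>vec c - \<nu>\<close>.  Moving from any other point towards the peak of a tent attaining the maximum
  increases the distance, so the local maxima are exactly the peaks.
\<close>

lemma crit_std_simplex:
  fixes G :: "'v::finite multigraph"
  assumes G: "loopless G" "graph_connected G"
  defines "c \<equiv> of_int (genus G - 1) / real CARD('v)"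
  shows "crit std_simplex (laplacian_lattice G) = (\<lambda>\<nu>. vec c - \<nu>) ` moderators G"
proof -
  let ?h = "dist_fun std_simplex (laplacian_lattice G)"
  note ge_iff = dist_fun_std_simplex_ge_iff[OF G]
  have deg_peak: "deg (vec c - \<nu>) = 0" if "\<nu> \<in> moderators G" for \<nu>
    using that by (simp add: moderators_def deg_diff deg_vec c_def)
  have h_le: "?h p \<le> 1 + c" and h_less: "p \<noteq> vec c - \<nu> \<Longrightarrow> ?h p < 1 + c"
    if p: "deg p = 0" and \<nu>: "\<nu> \<in> moderators G" and le: "\<And>i. ?h p \<le> \<nu> $ i + 1 + p $ i" for p \<nu>
  proof -
    have s: "(\<Sum>i\<in>UNIV. \<nu> $ i + 1 + p $ i) = (\<Sum>i\<in>(UNIV::'v set). 1 + c)"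
    proof -
      have "(\<Sum>i\<in>UNIV. \<nu> $ i + 1 + p $ i) = deg \<nu> + real CARD('v) + deg p"
        by (simp add: deg_def sum.distrib)
      then show ?thesis using \<nu> p by (simp add: moderators_def c_def distrib_left)
    qed
    have "(\<Sum>i\<in>(UNIV::'v set). ?h p) \<le> (\<Sum>i\<in>(UNIV::'v set). 1 + c)"
      unfolding s[symmetric] using le by (intro sum_mono)
    then show hle: "?h p \<le> 1 + c" by simp
    show "?h p < 1 + c" if ne: "p \<noteq> vec c - \<nu>"
    proof (rule ccontr)
      assume "\<not> ?h p < 1 + c"
      then have "?h p = 1 + c" using hle by simp
      then have nonneg: "0 \<le> \<nu> $ i + 1 + p $ i - (1 + c)" for i using le[of i] by simp
      have "(\<Sum>i\<in>UNIV. \<nu> $ i + 1 + p $ i - (1 + c)) = 0" unfolding sum_subtractf s by simp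
      then have "\<forall>i. \<nu> $ i + 1 + p $ i - (1 + c) = 0" using nonneg by (subst (asm) sum_nonneg_eq_0_iff) auto
      then have "p = vec c - \<nu>" by (simp add: vec_eq_iff algebra_simps)
      with ne show False by simp
    qed
  qed
  show ?thesis
  proof (intro equalityI subsetI)
    fix p assume "p \<in> crit std_simplex (laplacian_lattice G)"
    then have p: "deg p = 0" and ev: "\<forall>\<^sub>F q in at p within hyp 0. ?h q \<le> ?h p"
      by (auto simp: crit_def mem_hyp)
    obtain \<nu> where \<nu>: "\<nu> \<in> moderators G" and le: "\<And>i. ?h p \<le> \<nu> $ i + 1 + p $ i"
      using ge_iff[OF p, of "?h p"] by auto
    have "p = vec c - \<nu>"
    proof (rule ccontr)
      assume ne: "p \<noteq> vec c - \<nu>"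
      define w where "w = vec c - \<nu> - p"
      have w: "norm w > 0" "deg w = 0" using ne p deg_peak[OF \<nu>] by (simp_all add: w_def deg_diff)
      obtain d where d: "d > 0" "\<And>q. q \<in> hyp 0 \<Longrightarrow> q \<noteq> p \<Longrightarrow> dist q p < d \<Longrightarrow> ?h q \<le> ?h p"
        using ev unfolding eventually_at by blast
      \<comment> \<open>The step towards the peak stays short of the peak and within the neighbourhood of \<open>p\<close>.\<close>
      define s where "s = min (1/2) (d / (2 * norm w))"
      have s: "0 < s" "s < 1" "s * norm w < d"
      proof -
        show "0 < s" "s < 1" using d(1) w(1) by (simp_all add: s_def)
        have "s * norm w \<le> d / (2 * norm w) * norm w" unfolding s_def by (intro mult_right_mono) auto
        also have "\<dots> < d" using d(1) w(1) by simp
        finally show "s * norm w < d" .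
      qed
      define q where "q = p + s *\<^sub>R w"
      have q: "deg q = 0" using p w by (simp add: q_def deg_add deg_scaleR)
      have "(1 - s) * ?h p + s * (1 + c) \<le> \<nu> $ i + 1 + q $ i" for i
      proof -
        have "(1 - s) * ?h p \<le> (1 - s) * (\<nu> $ i + 1 + p $ i)"
          using le[of i] s(2) by (intro mult_left_mono) auto
        then show ?thesis by (simp add: q_def w_def algebra_simps)
      qed
      then have "(1 - s) * ?h p + s * (1 + c) \<le> ?h q" using ge_iff[OF q] \<nu> by blast
      moreover have "?h q \<le> ?h p"
      proof (rule d(2))
        show "q \<in> hyp 0" using q by (simp add: mem_hyp)
        show "q \<noteq> p" using s(1) w(1) by (simp add: q_def)
        show "dist q p < d" using s by (simp add: q_def dist_norm)
      qed
      moreover have "s * ?h p < s * (1 + c)" using h_less[OF p \<nu> le ne] s(1) by simp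
      ultimately show False by (simp add: left_diff_distrib)
    qed
    then show "p \<in> (\<lambda>\<nu>. vec c - \<nu>) ` moderators G" using \<nu> by blast
  next
    fix p assume "p \<in> (\<lambda>\<nu>. vec c - \<nu>) ` moderators G"
    then obtain \<nu> where \<nu>: "\<nu> \<in> moderators G" "p = vec c - \<nu>" by blast
    have p: "deg p = 0" using deg_peak \<nu> by simp
    have "1 + c \<le> ?h p" unfolding ge_iff[OF p] using \<nu> by (intro bexI[of _ \<nu>]) auto
    moreover have "?h q \<le> 1 + c" if "q \<in> hyp 0" for q
    proof -
      have q: "deg q = 0" using that by (simp add: mem_hyp)
      obtain \<nu>' where "\<nu>' \<in> moderators G" "\<And>i. ?h q \<le> \<nu>' $ i + 1 + q $ i"
        using ge_iff[OF q, of "?h q"] by auto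
      then show ?thesis using h_le[OF q] by blast
    qed
    ultimately have "\<And>q. q \<in> hyp 0 \<Longrightarrow> ?h q \<le> ?h p" by force
    then show "p \<in> crit std_simplex (laplacian_lattice G)"
      using p by (auto simp: crit_def mem_hyp eventually_at intro!: exI[of _ 1])
  qed
qed

lemma dist_fun_opp_simplex:
  "dist_fun opp_simplex (laplacian_lattice G) p = dist_fun std_simplex (laplacian_lattice G) (- p)"
proof -
  have "q \<in> (\<lambda>x. p + \<mu> *\<^sub>R x) ` opp_simplex \<longleftrightarrow> - q \<in> (\<lambda>x. - p + \<mu> *\<^sub>R x) ` std_simplex" for q :: "real ^ 'a" and \<mu>
  proof -
    have "q = p + \<mu> *\<^sub>R - x \<longleftrightarrow> - q = - p + \<mu> *\<^sub>R x" for x by (auto simp: algebra_simps)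
    then show ?thesis by (auto simp: opp_simplex_def image_iff)
  qed
  then have "conv_dist opp_simplex p q = conv_dist std_simplex (- p) (- q)" for q
    by (simp add: conv_dist_def)
  moreover have "uminus ` laplacian_lattice G = laplacian_lattice G"
    using laplacian_lattice_uminus[of _ G] by (force simp: image_iff)
  ultimately show ?thesis unfolding dist_fun_def by (metis (no_types, lifting) image_image image_cong)
qed

lemma crit_opp_simplex:
  "crit opp_simplex (laplacian_lattice G) = uminus ` crit std_simplex (laplacian_lattice G)"
proof -
  have *: "p \<in> crit opp_simplex (laplacian_lattice G) \<longleftrightarrow> - p \<in> crit std_simplex (laplacian_lattice G)" for p
  proof -
    have hyp: "- q \<in> hyp 0 \<longleftrightarrow> q \<in> hyp 0" for q :: "real ^ 'a" by (simp add: mem_hyp deg_minus)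
    have "dist (- q) (- p) = dist q p" for q by (simp add: dist_norm norm_minus_commute)
    then have "(\<forall>\<^sub>F q in at p within hyp 0. dist_fun std_simplex (laplacian_lattice G) (- q) \<le> u) \<longleftrightarrow>
        (\<forall>\<^sub>F q in at (- p) within hyp 0. dist_fun std_simplex (laplacian_lattice G) q \<le> u)" for u
      unfolding eventually_at using hyp by (metis minus_minus)
    then show ?thesis by (simp add: crit_def hyp dist_fun_opp_simplex)
  qed
  then show ?thesis by (force simp: image_iff)
qed

section \<open>Covering radii and ranks\<close>

lemma moderators_subset_hyp: "moderators G \<subseteq> hyp (of_int (genus G - 1))"
  by (auto simp: moderators_def mem_hyp)

lemma cov_radius_moderators_ge_iff:
  fixes G :: "'v::finite multigraph"
  assumes G: "loopless G" "graph_connected G" and "0 < \<kappa>" "0 < \<mu>"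
  shows "\<mu> \<le> cov_radius (of_int (genus G - 1)) (poly_P 1 \<kappa>) (moderators G) \<longleftrightarrow>
    (\<exists>p. deg p = of_int (genus G - 1) \<and>
      real CARD('v) * (\<mu> * \<kappa>) \<le> excess (moderators G) (p - vec (\<mu> * (1 - \<kappa>))))"
  by (rule cov_radius_poly_P_ge_iff[OF G(2) moderators_nonempty[OF G(1)] moderators_subset_hyp
        moderators_translate assms(3,4)])

lemma cov_radius_moderators_ge_iff_rank:
  fixes G :: "'v::finite multigraph"
  assumes G: "loopless G" "graph_connected G" and "0 < \<kappa>" "0 < \<mu>"
  shows "\<mu> \<le> cov_radius (of_int (genus G - 1)) (poly_P 1 \<kappa>) (moderators G) \<longleftrightarrow>
    (\<exists>D. deg D = of_int (genus G - 1) - real CARD('v) * (\<mu> * (1 - \<kappa>)) \<and>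
         real CARD('v) * (\<mu> * \<kappa>) - 1 \<le> div_rank G D)"
    (is "_ = ?R")
proof -
  let ?c = "\<mu> * (1 - \<kappa>)"
  have "\<mu> \<le> cov_radius (of_int (genus G - 1)) (poly_P 1 \<kappa>) (moderators G) \<longleftrightarrow>
    (\<exists>p. deg p = of_int (genus G - 1) \<and> real CARD('v) * (\<mu> * \<kappa>) \<le> excess (moderators G) (p - vec ?c))"
    (is "_ \<longleftrightarrow> (\<exists>p. ?P p)")
    by (rule cov_radius_moderators_ge_iff[OF G assms(3,4)])
  also have "\<dots> \<longleftrightarrow> ?R"
  proof
    assume "\<exists>p. ?P p"
    then obtain p where "?P p" by blast
    then show ?R by (intro exI[of _ "p - vec ?c"]) (auto simp: deg_diff deg_vec div_rank_eq_excess[OF G])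
  next
    assume ?R
    then obtain D where D: "deg D = of_int (genus G - 1) - real CARD('v) * ?c"
      "real CARD('v) * (\<mu> * \<kappa>) - 1 \<le> div_rank G D" by blast
    have "D + vec ?c - vec ?c = D" by simp
    with D show "\<exists>p. ?P p"
      by (intro exI[of _ "D + vec ?c"]) (simp add: deg_add deg_vec div_rank_eq_excess[OF G])
  qed
  finally show ?thesis .
qed

lemma cov_radius_crit_opp_simplex:
  fixes G :: "'v::finite multigraph"
  assumes G: "loopless G" "graph_connected G" and \<kappa>: "0 < \<kappa>" and \<mu>: "0 < \<mu>"
  shows "\<mu> \<le> cov_radius 0 (poly_P 1 \<kappa>) (crit opp_simplex (laplacian_lattice G)) \<longleftrightarrow>
    \<mu> \<le> cov_radius (of_int (genus G - 1)) (poly_P 1 \<kappa>) (moderators G)"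
proof -
  let ?N = "moderators G"
  define c where "c = of_int (genus G - 1) / real CARD('v)"
  let ?T = "(\<lambda>\<nu>. \<nu> - vec c) ` ?N"
  have T: "crit opp_simplex (laplacian_lattice G) = ?T"
    by (simp add: crit_opp_simplex crit_std_simplex[OF G] image_image c_def)
  have ne: "?N \<noteq> {}" by (rule moderators_nonempty[OF G(1)])
  have degN: "deg \<nu> = real CARD('v) * c" if "\<nu> \<in> ?N" for \<nu> using that by (simp add: moderators_def c_def)
  have deg_c: "real CARD('v) * c = of_int (genus G - 1)" by (simp add: c_def)
  have exc: "excess ?T x = excess ?N (x + vec c)" for x
    by (simp add: excess_def image_image algebra_simps)
  have "\<mu> \<le> cov_radius 0 (poly_P 1 \<kappa>) ?T \<longleftrightarrow>
    (\<exists>p. deg p = 0 \<and> real CARD('v) * (\<mu> * \<kappa>) \<le> excess ?T (p - vec (\<mu> * (1 - \<kappa>))))"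
  proof (rule cov_radius_poly_P_ge_iff[OF G(2) _ _ _ \<kappa> \<mu>])
    show "?T \<noteq> {}" using ne by simp
    show "?T \<subseteq> hyp 0" using degN by (auto simp: mem_hyp deg_diff deg_vec)
    show "t + laplacian G f \<in> ?T" if "t \<in> ?T" for t f
    proof -
      from that obtain \<nu> where \<nu>: "\<nu> \<in> ?N" "t = \<nu> - vec c" by blast
      then have "t + laplacian G f = (\<nu> + laplacian G f) - vec c" by simp
      then show ?thesis using moderators_translate[OF \<nu>(1)] by blast
    qed
  qed
  also have "\<dots> \<longleftrightarrow> (\<exists>p. deg p = of_int (genus G - 1) \<and>
      real CARD('v) * (\<mu> * \<kappa>) \<le> excess ?N (p - vec (\<mu> * (1 - \<kappa>))))" (is "(\<exists>p. ?P p) \<longleftrightarrow> (\<exists>p. ?Q p)")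
  proof
    assume "\<exists>p. ?P p"
    then obtain p where "?P p" by blast
    then have "?Q (p + vec c)" using deg_c by (simp add: exc deg_add deg_vec diff_add_eq)
    then show "\<exists>p. ?Q p" by blast
  next
    assume "\<exists>p. ?Q p"
    then obtain p where "?Q p" by blast
    then have "?P (p - vec c)" using deg_c by (simp add: exc deg_diff deg_vec diff_add_eq)
    then show "\<exists>p. ?P p" by blast
  qed
  also have "\<dots> \<longleftrightarrow> \<mu> \<le> cov_radius (of_int (genus G - 1)) (poly_P 1 \<kappa>) ?N"
    by (rule cov_radius_moderators_ge_iff[OF G \<kappa> \<mu>, symmetric])
  finally show ?thesis unfolding T .
qed

text \<open>
  Here the moderators are reflected.  Reflecting the polytope instead turns
  \<open>P\<^sub>1\<^sub>,\<^sub>\<kappa>\<close> into \<open>\<kappa>\<close> times the polytope with parameter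
  \<open>1 / \<kappa>\<close>.
\<close>

lemma cov_radius_crit_std_simplex:
  fixes G :: "'v::finite multigraph"
  assumes G: "loopless G" "graph_connected G" and \<kappa>: "0 < \<kappa>" and \<mu>: "0 < \<mu>"
  shows "\<mu> \<le> cov_radius 0 (poly_P 1 \<kappa>) (crit std_simplex (laplacian_lattice G)) \<longleftrightarrow>
    \<mu> * \<kappa> \<le> cov_radius (of_int (genus G - 1)) (poly_P 1 (1 / \<kappa>)) (moderators G)"
proof -
  let ?N = "moderators G"
  let ?n = "real CARD('v)"
  define c where "c = of_int (genus G - 1) / ?n"
  let ?T = "(\<lambda>\<nu>. vec c - \<nu>) ` ?N"
  have T: "crit std_simplex (laplacian_lattice G) = ?T"
    by (simp add: crit_std_simplex[OF G] c_def)
  have ne: "?N \<noteq> {}" by (rule moderators_nonempty[OF G(1)])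
  have degN: "deg \<nu> = ?n * c" if "\<nu> \<in> ?N" for \<nu> using that by (simp add: moderators_def c_def)
  have "\<mu> \<le> cov_radius 0 (poly_P 1 \<kappa>) ?T \<longleftrightarrow>
    (\<exists>p. deg p = 0 \<and> ?n * (\<mu> * \<kappa>) \<le> excess ?T (p - vec (\<mu> * (1 - \<kappa>))))"
  proof (rule cov_radius_poly_P_ge_iff[OF G(2) _ _ _ \<kappa> \<mu>])
    show "?T \<noteq> {}" using ne by simp
    show "?T \<subseteq> hyp 0" using degN by (auto simp: mem_hyp deg_diff deg_vec)
    show "t + laplacian G f \<in> ?T" if "t \<in> ?T" for t f
    proof -
      from that obtain \<nu> where \<nu>: "\<nu> \<in> ?N" "t = vec c - \<nu>" by blast
      then have "t + laplacian G f = vec c - (\<nu> + laplacian G (\<lambda>v. - f v))" by (simp add: laplacian_minus)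
      then show ?thesis using moderators_translate[OF \<nu>(1)] by blast
    qed
  qed
  also have "\<dots> \<longleftrightarrow> (\<exists>p. deg p = of_int (genus G - 1) \<and>
      ?n * (\<mu> * \<kappa> * (1 / \<kappa>)) \<le> excess ?N (p - vec (\<mu> * \<kappa> * (1 - 1 / \<kappa>))))" (is "(\<exists>p. ?P p) \<longleftrightarrow> (\<exists>p. ?Q p)")
  proof -
    have PQ: "?P p \<longleftrightarrow> ?Q (vec c - p)" for p
    proof -
      have iff: "?n * (\<mu> * \<kappa>) \<le> pos_deg (p - vec (\<mu> * (1 - \<kappa>)) - (vec c - \<nu>)) \<longleftrightarrow>
          ?n * (\<mu> * \<kappa> * (1 / \<kappa>)) \<le> pos_deg (vec c - p - vec (\<mu> * \<kappa> * (1 - 1 / \<kappa>)) - \<nu>)"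
        if \<nu>: "\<nu> \<in> ?N" and p: "deg p = 0" for \<nu>
      proof -
        let ?y = "vec c - p - vec (\<mu> * \<kappa> * (1 - 1 / \<kappa>)) - \<nu>"
        have e: "\<mu> * \<kappa> * (1 - 1 / \<kappa>) = - (\<mu> * (1 - \<kappa>))" using \<kappa> by (simp add: field_simps)
        have "p - vec (\<mu> * (1 - \<kappa>)) - (vec c - \<nu>) = - ?y" unfolding e by (simp add: vec_eq_iff)
        moreover have "deg ?y = ?n * \<mu> - ?n * (\<mu> * \<kappa>)"
          using degN[OF \<nu>] p unfolding e by (simp only: deg_diff deg_vec) (simp add: algebra_simps)
        ultimately have "pos_deg (p - vec (\<mu> * (1 - \<kappa>)) - (vec c - \<nu>)) = pos_deg ?y - (?n * \<mu> - ?n * (\<mu> * \<kappa>))"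
          by (simp only: pos_deg_minus)
        moreover have "\<mu> * \<kappa> * (1 / \<kappa>) = \<mu>" using \<kappa> by simp
        ultimately show ?thesis by auto
      qed
      have "deg (vec c - p) = of_int (genus G - 1) \<longleftrightarrow> deg p = 0" by (simp add: deg_diff deg_vec c_def)
      then show ?thesis using ne iff by (auto simp: excess_ge_iff)
    qed
    show ?thesis
    proof
      assume "\<exists>p. ?P p"
      then show "\<exists>p. ?Q p" using PQ by blast
    next
      assume "\<exists>p. ?Q p"
      then obtain p where "?Q p" by blast
      moreover have "vec c - (vec c - p) = p" by simp
      ultimately have "?P (vec c - p)" using PQ[of "vec c - p"] by (simp only:)
      then show "\<exists>p. ?P p" by blast
    qed
  qed
  also have "\<dots> \<longleftrightarrow> \<mu> * \<kappa> \<le> cov_radius (of_int (genus G - 1)) (poly_P 1 (1 / \<kappa>)) ?N"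
    using \<kappa> \<mu> by (intro cov_radius_moderators_ge_iff[OF G, symmetric]) auto
  finally show ?thesis unfolding T .
qed

text \<open>
  The rank takes all values between its minimum on divisors of degree \<open>d\<close>, attained at
  a moderator shifted by a constant, and any value that it takes there.
\<close>

lemma exists_divisor_of_rank:
  fixes G :: "'v::finite multigraph"
  assumes G: "loopless G" "graph_connected G"
    and D: "deg D1 = d" "r \<le> div_rank G D1"
    and r: "-1 \<le> r" "d - of_int (genus G) \<le> r"
  obtains D where "deg D = d" "div_rank G D = r"
proof -
  let ?N = "moderators G"
  have ne: "?N \<noteq> {}" by (rule moderators_nonempty[OF G(1)])
  then obtain \<nu> where \<nu>: "\<nu> \<in> ?N" by blast
  define c where "c = (d - of_int (genus G - 1)) / real CARD('v)"
  define D0 where "D0 = \<nu> + vec c"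
  have degD0: "deg D0 = d" using \<nu> by (simp add: D0_def moderators_def deg_add deg_vec c_def)
  have "excess ?N D0 \<le> pos_deg (vec c :: real ^ 'v)"
    using excess_le[OF \<nu>, of D0] by (simp add: D0_def)
  also have "\<dots> = max 0 (d - of_int (genus G - 1))"
    by (auto simp: pos_deg_vec c_def max_def divide_le_0_iff zero_le_divide_iff)
  also have "\<dots> \<le> r + 1" using r by simp
  finally have D0: "div_rank G D0 \<le> r" by (simp add: div_rank_eq_excess[OF G])
  define \<phi> where "\<phi> s = D0 + s *\<^sub>R (D1 - D0)" for s :: real
  have "continuous_on {0..1} (\<lambda>s. excess ?N (\<phi> s) - 1)"
    unfolding \<phi>_def
    by (intro continuous_on_diff continuous_on_const continuous_on_compose2[OF continuous_on_excess[OF ne, of UNIV]] continuous_intros) auto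
  then have "continuous_on {0..1} (\<lambda>s. div_rank G (\<phi> s))" by (simp add: div_rank_eq_excess[OF G])
  moreover have "div_rank G (\<phi> 0) \<le> r" "r \<le> div_rank G (\<phi> 1)" using D0 D(2) by (simp_all add: \<phi>_def)
  ultimately obtain s where "div_rank G (\<phi> s) = r"
    using IVT'[of "\<lambda>s. div_rank G (\<phi> s)" 0 r 1] by auto
  moreover have "deg (\<phi> s) = d" using degD0 D(1) by (simp add: \<phi>_def deg_add deg_scaleR deg_diff)
  ultimately show ?thesis by (intro that)
qed

lemma div_rank_mono:
  fixes G :: "'v::finite multigraph"
  assumes "loopless G" "graph_connected G" "\<And>v. D $ v \<le> D' $ v"
  shows "div_rank G D \<le> div_rank G D'"
  using excess_mono[OF moderators_nonempty[OF assms(1)] assms(3)] by (simp add: div_rank_eq_excess assms)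

theorem mainTheorem5:
  fixes G :: "'v::finite multigraph"
  assumes "CARD('v) \<ge> 2"
    and "loopless G" and "graph_connected G"
    and "genus G \<ge> 1"
  defines "n \<equiv> real CARD('v)" and "g \<equiv> real_of_int (genus G)"
  shows
    "(\<forall>r d :: real. 0 \<le> r \<and> 0 \<le> d \<and> d \<le> 2 * g - 2 \<and> g - (r + 1) * (g - d + r) \<ge> 0 \<longrightarrow>
        (\<exists>D. deg D \<le> d \<and> div_rank G D = r) \<and>
        (g - d + r \<ge> 1 \<longrightarrow> (\<exists>D. deg D = d \<and> div_rank G D = r)))
     \<longleftrightarrow>
     (\<forall>\<kappa> \<in> {1 / g .. g}.
        cov_radius (g - 1) (poly_P 1 \<kappa>) (nonspecial G) \<ge> sqrt (g / \<kappa>) / n \<and>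
        cov_radius 0 (poly_P 1 \<kappa>) (crit std_simplex (laplacian_lattice G)) \<ge> sqrt (g / \<kappa>) / n \<and>
        cov_radius 0 (poly_P 1 \<kappa>) (crit opp_simplex (laplacian_lattice G)) \<ge> sqrt (g / \<kappa>) / n)"
    (is "?A \<longleftrightarrow> ?B")
proof -
  note G = assms(2,3)
  have g1: "1 \<le> g" using assms(4) by (simp add: g_def)
  have n0: "0 < n" by (simp add: n_def)
  define deg_of where "deg_of \<kappa> = g - 1 + sqrt (g * \<kappa>) - sqrt (g / \<kappa>)" for \<kappa>
  \<comment> \<open>The existence statement to which both sides reduce: a divisor on the boundary curve of rank at
     least the prescribed one.\<close>
  define W where "W \<kappa> \<longleftrightarrow> (\<exists>D. deg D = deg_of \<kappa> \<and> sqrt (g * \<kappa>) - 1 \<le> div_rank G D)" for \<kappa>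
  have sqrt_mult: "sqrt (g / \<kappa>) * \<kappa> = sqrt (g * \<kappa>)" if "0 < \<kappa>" for \<kappa>
  proof -
    have "sqrt (g / \<kappa>) * \<kappa> = sqrt (g / \<kappa>) * sqrt (\<kappa> * \<kappa>)" using that by simp
    also have "\<dots> = sqrt (g / \<kappa> * (\<kappa> * \<kappa>))" by (rule real_sqrt_mult[symmetric])
    also have "g / \<kappa> * (\<kappa> * \<kappa>) = g * \<kappa>" using that by simp
    finally show ?thesis .
  qed
  have pos: "0 < \<kappa>" if "\<kappa> \<in> {1 / g .. g}" for \<kappa>
  proof -
    have "0 < 1 / g" using g1 by simp
    also have "\<dots> \<le> \<kappa>" using that by simp
    finally show ?thesis .
  qed
  have cov_W: "sqrt (g / \<kappa>) / n \<le> cov_radius (of_int (genus G - 1)) (poly_P 1 \<kappa>) (moderators G) \<longleftrightarrow> W \<kappa>"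
    if \<kappa>: "0 < \<kappa>" for \<kappa>
  proof -
    let ?\<mu> = "sqrt (g / \<kappa>) / n"
    have "real CARD('v) * (?\<mu> * \<kappa>) = sqrt (g * \<kappa>)"
      using sqrt_mult[OF \<kappa>] n0 by (simp add: n_def[symmetric])
    moreover have "of_int (genus G - 1) - real CARD('v) * (?\<mu> * (1 - \<kappa>)) = deg_of \<kappa>"
      using sqrt_mult[OF \<kappa>] n0 by (simp add: n_def[symmetric] g_def[symmetric] deg_of_def right_diff_distrib)
    moreover have "0 < ?\<mu>" using g1 \<kappa> n0 by simp
    ultimately show ?thesis
      using cov_radius_moderators_ge_iff_rank[OF G \<kappa>, of ?\<mu>] by (simp only: W_def)
  qed
  have B_iff: "?B \<longleftrightarrow> (\<forall>\<kappa>\<in>{1 / g .. g}. W \<kappa>)"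
  proof -
    have e: "g - 1 = of_int (genus G - 1)" by (simp add: g_def)
    have "(sqrt (g / \<kappa>) / n \<le> cov_radius (g - 1) (poly_P 1 \<kappa>) (nonspecial G) \<longleftrightarrow> W \<kappa>) \<and>
      (sqrt (g / \<kappa>) / n \<le> cov_radius 0 (poly_P 1 \<kappa>) (crit std_simplex (laplacian_lattice G)) \<longleftrightarrow> W (1 / \<kappa>)) \<and>
      (sqrt (g / \<kappa>) / n \<le> cov_radius 0 (poly_P 1 \<kappa>) (crit opp_simplex (laplacian_lattice G)) \<longleftrightarrow> W \<kappa>)"
      if "\<kappa> \<in> {1 / g .. g}" for \<kappa>
    proof -
      note \<kappa> = pos[OF that]
      have \<mu>: "0 < sqrt (g / \<kappa>) / n" using g1 \<kappa> n0 by simp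
      have m: "sqrt (g / \<kappa>) / n * \<kappa> = sqrt (g / (1 / \<kappa>)) / n" using sqrt_mult[OF \<kappa>] by simp
      have "sqrt (g / \<kappa>) / n \<le> cov_radius 0 (poly_P 1 \<kappa>) (crit std_simplex (laplacian_lattice G)) \<longleftrightarrow> W (1 / \<kappa>)"
        unfolding cov_radius_crit_std_simplex[OF G \<kappa> \<mu>] m by (rule cov_W) (use \<kappa> in simp)
      then show ?thesis
        unfolding cov_radius_crit_opp_simplex[OF G \<kappa> \<mu>] e nonspecial_eq_moderators[OF G] using cov_W[OF \<kappa>] by blast
    qed
    moreover have "1 / \<kappa> \<in> {1 / g .. g}" if "\<kappa> \<in> {1 / g .. g}" for \<kappa>
      using that pos[OF that] g1 by (simp add: field_simps)
    ultimately show ?thesis by blast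
  qed
  have "?A \<longleftrightarrow> (\<forall>\<kappa>\<in>{1 / g .. g}. W \<kappa>)"
  proof
    assume A: ?A
    show "\<forall>\<kappa>\<in>{1 / g .. g}. W \<kappa>"
    proof
      fix \<kappa> assume \<kappa>: "\<kappa> \<in> {1 / g .. g}"
      note \<kappa>0 = pos[OF \<kappa>]
      define r where "r = sqrt (g * \<kappa>) - 1"
      have "1 \<le> g * \<kappa>" "g * \<kappa> \<le> g * g" "1 \<le> g / \<kappa>" "g / \<kappa> \<le> g * g"
        using \<kappa> \<kappa>0 g1 by (simp_all add: field_simps)
      then have "1 \<le> sqrt (g * \<kappa>)" "sqrt (g * \<kappa>) \<le> sqrt (g * g)" "1 \<le> sqrt (g / \<kappa>)" "sqrt (g / \<kappa>) \<le> sqrt (g * g)"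
        by (simp_all only: real_sqrt_le_iff real_sqrt_ge_1_iff)
      then have b: "1 \<le> sqrt (g * \<kappa>)" "sqrt (g * \<kappa>) \<le> g" "1 \<le> sqrt (g / \<kappa>)" "sqrt (g / \<kappa>) \<le> g"
        using g1 by simp_all
      have "sqrt (g * \<kappa>) * sqrt (g / \<kappa>) = sqrt (g * g)"
        using \<kappa>0 by (simp add: real_sqrt_mult[symmetric])
      then have "sqrt (g * \<kappa>) * sqrt (g / \<kappa>) = g" using g1 by simp
      then have "g - (r + 1) * (g - deg_of \<kappa> + r) \<ge> 0" by (simp add: r_def deg_of_def)
      moreover have "0 \<le> r" "0 \<le> deg_of \<kappa>" "deg_of \<kappa> \<le> 2 * g - 2" "1 \<le> g - deg_of \<kappa> + r"
        using b unfolding r_def deg_of_def by linarith+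
      ultimately obtain D where "deg D = deg_of \<kappa>" "div_rank G D = r" using A by blast
      then show "W \<kappa>" unfolding W_def r_def by (intro exI[of _ D]) simp
    qed
  next
    assume B: "\<forall>\<kappa>\<in>{1 / g .. g}. W \<kappa>"
    show ?A
    proof (intro allI impI)
      fix r d :: real
      assume *: "0 \<le> r \<and> 0 \<le> d \<and> d \<le> 2 * g - 2 \<and> g - (r + 1) * (g - d + r) \<ge> 0"
      have rg: "r + 1 \<le> g"
      proof (cases "1 \<le> g - d + r")
        case True
        then have "(r + 1) * 1 \<le> (r + 1) * (g - d + r)" using * by (intro mult_left_mono) auto
        then show ?thesis using * unfolding mult_1_right by linarith
      next
        case False
        then show ?thesis using * by simp
      qed
      \<comment> \<open>The degree \<open>d'\<close> is the one for which \<open>(r + 1) (g - d' + r) = g\<close>.\<close>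
      define \<kappa> where "\<kappa> = (r + 1)\<^sup>2 / g"
      define d' where "d' = g + r - g / (r + 1)"
      have "1 \<le> (r + 1)\<^sup>2" using * by simp
      moreover have "(r + 1)\<^sup>2 \<le> g\<^sup>2" using rg * by (intro power_mono) auto
      ultimately have \<kappa>: "\<kappa> \<in> {1 / g .. g}" using g1 by (simp add: \<kappa>_def field_simps power2_eq_square)
      have s1: "sqrt (g * \<kappa>) = r + 1" using g1 * by (simp add: \<kappa>_def)
      have "g / \<kappa> = (g / (r + 1))\<^sup>2" using g1 by (simp add: \<kappa>_def power2_eq_square)
      then have s2: "sqrt (g / \<kappa>) = g / (r + 1)" using g1 * by simp
      have "deg_of \<kappa> = d'" by (simp add: deg_of_def d'_def s1 s2)
      moreover have "W \<kappa>" using B \<kappa> by blast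
      ultimately obtain D1 where D1: "deg D1 = d'" "r \<le> div_rank G D1"
        unfolding W_def s1 by auto
      have q1: "1 \<le> g / (r + 1)" using rg * by simp
      have d'd: "d' \<le> d"
      proof (cases "1 \<le> g - d + r")
        case True
        have "g - d + r \<le> g / (r + 1)" using * by (simp add: field_simps)
        then show ?thesis by (simp add: d'_def)
      next
        case False
        then show ?thesis using q1 by (simp add: d'_def)
      qed
      have "d' - of_int (genus G) \<le> r" using q1 by (simp add: d'_def g_def[symmetric])
      then obtain D where D: "deg D = d'" "div_rank G D = r"
        using exists_divisor_of_rank[OF G D1] * by auto
      have "\<exists>D. deg D = d \<and> div_rank G D = r" if ge: "1 \<le> g - d + r"
      proof -
        let ?D = "D + vec ((d - d') / n)"
        have "deg ?D = d" using D(1) n0 by (simp add: deg_add deg_vec n_def[symmetric])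
        moreover have "r \<le> div_rank G ?D"
          using div_rank_mono[OF G, of D ?D] D(2) d'd n0 by simp
        moreover have "d - of_int (genus G) \<le> r" using ge by (simp add: g_def[symmetric])
        ultimately show ?thesis using exists_divisor_of_rank[OF G, of ?D d r] * by auto
      qed
      then show "(\<exists>D. deg D \<le> d \<and> div_rank G D = r) \<and>
        (g - d + r \<ge> 1 \<longrightarrow> (\<exists>D. deg D = d \<and> div_rank G D = r))"
        using D d'd by blast
    qed
  qed
  with B_iff show ?thesis by simp
qed

end
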